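(* Let $T>0$, $N\ge 1$ an integer, $\tau=T/N$ (with no further restriction on $\tau$). Let $\hat{\mathbf{u}}_0=\boldsymbol{u}_0$, let $p_0$ be a given initial pressure (approximation), and let $(\rho_n,\boldsymbol{u}_n,p_n,\hat{\mathbf{u}}_n)_{n=0}^N$ satisfy, for $n=0,\dots,N-1$, the fractional-step IMEX scheme in $\Omega$: (1) $$\frac{\rho_{n+1}-\rho_n}{\tau} + \hat{\mathbf{u}}_n\cdot\nabla\rho_{n+1} + \frac{\nabla\cdot\hat{\mathbf{u}}_{n}}{2}\rho_{n+1} = 0;$$ (2) $$\frac{\rho_{n+1}}{\tau}\boldsymbol{u}_{n+1} + (\rho_{n+1}\nabla\boldsymbol{u}_{n+1})\boldsymbol{u}_n + \tfrac{1}{2}[\nabla\cdot(\rho_{n+1}\boldsymbol{u}_n)]\boldsymbol{u}_{n+1} -\nabla\cdot(\mu_{n+1}\nabla\boldsymbol{u}_{n+1}) = \frac{\sqrt{\rho_{n+1}\rho_n}}{\tau}\hat{\mathbf{u}}_{n} - \sqrt{\frac{\rho_{n+1}}{\rho_n}}\,\nabla p_{n} + \nabla^{\top}\boldsymbol{u}_{n}\nabla\mu_{n+1} + \boldsymbol{f}_{n+1},\qquad \boldsymbol{u}_{n+1}|_{\partial\Omega}=\boldsymbol{0};$$ (3) $$-\nabla\cdot\Big(\frac{1}{\rho_{n+1}}\nabla p_{n+1}\Big) = -\nabla\cdot\Big(\frac{1}{\sqrt{\rho_n\rho_{n+1}}}\nabla p_{n}\Big) - \frac{1}{\tau}\nabla\cdot\boldsymbol{u}_{n+1},\qquad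 \Big[\boldsymbol{n}\cdot\Big(\frac{1}{\sqrt{\rho_{n+1}}}\nabla p_{n+1} - \frac{1}{\sqrt{\rho_{n}}}\nabla p_{n}\Big)\Big]\Big|_{\partial\Omega} = 0;$$ (4) $$\hat{\mathbf{u}}_{n+1} = \boldsymbol{u}_{n+1} - \frac{\tau}{\sqrt{\rho_{n+1}}}\left(\frac{1}{\sqrt{\rho_{n+1}}}\nabla p_{n+1}-\frac{1}{\sqrt{\rho_{n}}}\nabla p_{n}\right),$$ under the standing assumptions given in the context. Then, for all positive constants $\varepsilon,\epsilon$ with $\varepsilon+\epsilon\le 2$, $$\|\sqrt{\rho_N}\,\hat{\mathbf{u}}_{N}\|^2 + \tau\varepsilon\|\sqrt{\mu_N}\,\nabla\boldsymbol{u}_{N}\|^2 + \tau^2\left\|\frac{1}{\sqrt{\rho_{N}}}\nabla p_{N}\right\|^2 + (2-\epsilon-\varepsilon)\tau\sum_{n=1}^{N}\big\|\sqrt{\mu_{n}}\,\nabla\boldsymbol{u}_{n}\big\|^2 \le \left(C + \sum_{n=1}^{N}\frac{\tau}{\epsilon\mu_{\mathrm{min}}}\|\boldsymbol{f}_{n}\|_{-1}^2\right)\exp\left(\frac{T\|\nabla\mu\|_{\infty}^2}{\varepsilon\varrho_{\mathrm{min}}\mu_{\mathrm{min}}}\right),$$ where $C$ is a positive constant depending only on the initial conditions (including $p_0$), on the problem data and on $\tau$, and which does not grow with decreasing $\tau$ (i.e. $\partial_\tau C\ge 0$ for all $\tau>0$).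
   Context: Setting: $\Omega\subset\mathbb{R}^d$, $d\in\{2,3\}$, is a domain with outward unit normal $\boldsymbol{n}$ on $\partial\Omega$, and $Q=\Omega\times(0,T]$. The scheme is a time discretisation (continuous in space) of the incompressible Navier--Stokes equations with variable density $\rho>0$ and variable dynamic viscosity $\mu$, velocity $\boldsymbol{u}$, pressure $p$, body force $\boldsymbol{f}$; $\hat{\mathbf{u}}_n$ is the "end-of-step" (projected) velocity. A subscript $n$ denotes the approximation (or the given value) at time $t_n=n\tau$. Notation: $(\cdot,\cdot)$ and $\|\cdot\|$ are the $L^2(\Omega)$ inner product and norm (for scalar, vector or tensor fields, with the Euclidean/Frobenius norm pointwise); $\langle\cdot,\cdot\rangle$ is the duality pairing between $H^{-1}(\Omega)$ and $H^1_0(\Omega)$; $\|\cdot\|_{-1}$ is the $H^{-1}(\Omega)$ norm, dual to the norm $\|\nabla\cdot\|$ on $H^1_0(\Omega)$, so $\langle \boldsymbol{f},\boldsymbol{v}\rangle\le\|\boldsymbol{f}\|_{-1}\|\nabla\boldsymbol{v}\|$; $\|\cdot\|_\infty$ is the $L^\infty(\bar Q)$ norm. $(\nabla\boldsymbol{u})_{ij}=\partial_j u^i$, and $(\nabla^{\top}\boldsymbol{u}\,\nabla\mu)_i=\sum_j \partial_i u^j\,\partial_j\mu$. Standing assumptions: - $\boldsymbol{f}_n\in[H^{-1}(\Omega)]^d$ for all $n$; the initial velocity satisfies $\boldsymbol{u}_0\in[H^1_0(\Omega)]^d$; the initial density satisfies $0<\rho_{\min}\le\rho_0\le\rho_{\max}$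 in $\Omega$, with constants $\rho_{\min},\rho_{\max}$. - Viscosity: $\mu\ge\mu_{\min}>0$ in $\bar Q$ with $\mu_{\min}$ constant, and $\nabla\mu\in[L^\infty(\bar Q)]^d$; the viscosities $\mu_n$ at the time steps, which are known when $\boldsymbol{u}_n$ is computed, obey the same bounds: $\mu_n\ge\mu_{\min}$ and $|\nabla\mu_n|\le\|\nabla\mu\|_\infty$ a.e. in $\Omega$. - The numerical density satisfies $\rho_n\ge\varrho_{\min}$ a.e. in $\Omega$ for all $n=0,\dots,N$, with a constant $\varrho_{\min}\in(0,\rho_{\min}]$. - Homogeneous Dirichlet conditions $\boldsymbol{u}_n=\boldsymbol{0}$ on $\partial\Omega$ for all $n$ (so no boundary condition is needed for $\rho$). - All fields (including $p_0$, with $\nabla p_0\in[L^2(\Omega)]^d$) are sufficiently smooth for the equations to be tested with $\boldsymbol{u}_{n+1}$, $p_{n+1}$ and $\rho_{n+1}\hat{\mathbf{u}}_{n+1}$ respectively, with integration by parts, and for the identity $\int_\Omega\big[(r\nabla\boldsymbol{v})\boldsymbol{w}+\tfrac12(\nabla\cdot(r\boldsymbol{w}))\boldsymbol{v}\big]\cdot\boldsymbol{v}\,\mathrm{d}\Omega=0$ to hold with $r=\rho_{n+1}$, $\boldsymbol{v}=\boldsymbol{u}_{n+1}$, $\boldsymbol{w}=\boldsymbol{u}_n$. Constants: the property $\partial_\tau C\ge0$ is understood with the other arguments of $C$ (initial conditions, problem data) held fixed. *)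

theory Defs
  imports "HOL-Analysis.Analysis" "HOL-Probability.Essential_Supremum"
begin

section \<open>Weak derivatives and Sobolev spaces\<close>

definition dir_deriv :: "'a::euclidean_space \<Rightarrow> ('a \<Rightarrow> real) \<Rightarrow> 'a \<Rightarrow> real" where
  "dir_deriv e f x = frechet_derivative f (at x) e"

fun cont_diff :: "nat \<Rightarrow> ('a::euclidean_space \<Rightarrow> real) \<Rightarrow> bool" where
  "cont_diff 0 f = continuous_on UNIV f"
| "cont_diff (Suc k) f = ((\<forall>x. f differentiable at x) \<and> (\<forall>b\<in>Basis. cont_diff k (dir_deriv b f)))"

text \<open>\<open>C\<^sub>c\<^sup>\<infinity>(S)\<close>, the functions being extended by zero to the whole space.\<close>

definition test_functions :: "'a::euclidean_space set \<Rightarrow> ('a \<Rightarrow> real) set" where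
  "test_functions S = {\<phi>. (\<forall>k. cont_diff k \<phi>) \<and>
     compact (closure {x. \<phi> x \<noteq> 0}) \<and> closure {x. \<phi> x \<noteq> 0} \<subseteq> S}"

definition loc_integrable :: "'a::euclidean_space set \<Rightarrow> ('a \<Rightarrow> real) \<Rightarrow> bool" where
  "loc_integrable S f \<longleftrightarrow> f \<in> borel_measurable (lebesgue_on S) \<and>
     (\<forall>K. compact K \<and> K \<subseteq> S \<longrightarrow> integrable (lebesgue_on K) f)"

definition has_weak_deriv ::
  "'a::euclidean_space set \<Rightarrow> 'a \<Rightarrow> ('a \<Rightarrow> real) \<Rightarrow> ('a \<Rightarrow> real) \<Rightarrow> bool" where
  "has_weak_deriv S e f g \<longleftrightarrow> loc_integrable S f \<and> loc_integrable S g \<and>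
     (\<forall>\<phi>\<in>test_functions S.
        (LINT x|lebesgue_on S. f x * dir_deriv e \<phi> x) = - (LINT x|lebesgue_on S. g x * \<phi> x))"

text \<open>The weak derivative is determined almost everywhere; \<open>weak_deriv\<close> picks a representative
  and is meaningful only where a weak derivative exists.\<close>

definition weak_deriv :: "'a::euclidean_space set \<Rightarrow> 'a \<Rightarrow> ('a \<Rightarrow> real) \<Rightarrow> 'a \<Rightarrow> real" where
  "weak_deriv S e f = (SOME g. has_weak_deriv S e f g)"

definition weakly_diff :: "(real^'d) set \<Rightarrow> (real^'d \<Rightarrow> real) \<Rightarrow> bool" where
  "weakly_diff \<Omega> f \<longleftrightarrow> (\<forall>i. \<exists>g. has_weak_deriv \<Omega> (axis i 1) f g)"

definition weakly_diff_vec :: "(real^'d) set \<Rightarrow> (real^'d \<Rightarrow> real^'d) \<Rightarrow> bool" where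
  "weakly_diff_vec \<Omega> v \<longleftrightarrow> (\<forall>i. weakly_diff \<Omega> (\<lambda>x. v x $ i))"

definition grad :: "(real^'d) set \<Rightarrow> (real^'d \<Rightarrow> real) \<Rightarrow> real^'d \<Rightarrow> real^'d" where
  "grad \<Omega> f x = (\<chi> i. weak_deriv \<Omega> (axis i 1) f x)"

text \<open>Row \<open>i\<close> of the velocity gradient is the gradient of component \<open>i\<close>:
  \<open>grad_vec \<Omega> v x $ i $ j = \<partial>\<^sub>j v\<^sup>i\<close>.\<close>

definition grad_vec :: "(real^'d) set \<Rightarrow> (real^'d \<Rightarrow> real^'d) \<Rightarrow> real^'d \<Rightarrow> real^'d^'d" where
  "grad_vec \<Omega> v x = (\<chi> i. grad \<Omega> (\<lambda>y. v y $ i) x)"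

definition divg :: "(real^'d) set \<Rightarrow> (real^'d \<Rightarrow> real^'d) \<Rightarrow> real^'d \<Rightarrow> real" where
  "divg \<Omega> v x = (\<Sum>i\<in>UNIV. weak_deriv \<Omega> (axis i 1) (\<lambda>y. v y $ i) x)"

text \<open>On \<open>real^'d\<close> and \<open>real^'d^'d\<close> the library norm is the Euclidean and the Frobenius norm.\<close>

definition in_L2 :: "'a::euclidean_space set \<Rightarrow> ('a \<Rightarrow> 'b::euclidean_space) \<Rightarrow> bool" where
  "in_L2 S f \<longleftrightarrow> f \<in> borel_measurable (lebesgue_on S) \<and>
     integrable (lebesgue_on S) (\<lambda>x. (norm (f x))\<^sup>2)"

definition L2_norm :: "'a::euclidean_space set \<Rightarrow> ('a \<Rightarrow> 'b::euclidean_space) \<Rightarrow> real" where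
  "L2_norm S f = sqrt (LINT x|lebesgue_on S. (norm (f x))\<^sup>2)"

definition in_Linf :: "'a::euclidean_space set \<Rightarrow> ('a \<Rightarrow> 'b::euclidean_space) \<Rightarrow> bool" where
  "in_Linf S f \<longleftrightarrow> f \<in> borel_measurable (lebesgue_on S) \<and>
     (\<exists>K. AE x in lebesgue_on S. norm (f x) \<le> K)"

definition Linf_norm :: "'a::euclidean_space set \<Rightarrow> ('a \<Rightarrow> 'b::euclidean_space) \<Rightarrow> real" where
  "Linf_norm S f = real_of_ereal (esssup (lebesgue_on S) (\<lambda>x. ereal (norm (f x))))"

definition H1 :: "(real^'d) set \<Rightarrow> (real^'d \<Rightarrow> real) set" where
  "H1 \<Omega> = {f. in_L2 \<Omega> f \<and> weakly_diff \<Omega> f \<and> in_L2 \<Omega> (grad \<Omega> f)}"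

text \<open>\<open>H\<^sup>1\<^sub>0(\<Omega>)\<close> is the closure of the test functions in \<open>H\<^sup>1(\<Omega>)\<close>; membership encodes the
  homogeneous Dirichlet condition.\<close>

definition H10 :: "(real^'d) set \<Rightarrow> (real^'d \<Rightarrow> real) set" where
  "H10 \<Omega> = {f \<in> H1 \<Omega>. \<exists>\<phi>::nat \<Rightarrow> real^'d \<Rightarrow> real. (\<forall>k. \<phi> k \<in> test_functions \<Omega>) \<and>
     (\<lambda>k. L2_norm \<Omega> (\<lambda>x. \<phi> k x - f x)) \<longlonglongrightarrow> 0 \<and>
     (\<lambda>k. L2_norm \<Omega> (\<lambda>x. (\<chi> i. dir_deriv (axis i 1) (\<phi> k) x) - grad \<Omega> f x)) \<longlonglongrightarrow> 0}"

definition H10_vec :: "(real^'d) set \<Rightarrow> (real^'d \<Rightarrow> real^'d) set" where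
  "H10_vec \<Omega> = {v. \<forall>i. (\<lambda>x. v x $ i) \<in> H10 \<Omega>}"

text \<open>\<open>[H\<^sup>-\<^sup>1(\<Omega>)]\<^sup>d\<close>: an element is given by its duality pairing with \<open>[H\<^sup>1\<^sub>0(\<Omega>)]\<^sup>d\<close>; the values
  off \<open>[H\<^sup>1\<^sub>0(\<Omega>)]\<^sup>d\<close> are irrelevant. The norm is dual to the norm \<open>\<parallel>\<nabla>\<cdot>\<parallel>\<close>;
  division by zero yields \<open>0\<close>, so \<open>v = 0\<close> does not contribute to the supremum.\<close>

definition Hm1_vec :: "(real^'d) set \<Rightarrow> ((real^'d \<Rightarrow> real^'d) \<Rightarrow> real) set" where
  "Hm1_vec \<Omega> = {F.
     (\<forall>v\<in>H10_vec \<Omega>. \<forall>w\<in>H10_vec \<Omega>. F (\<lambda>x. v x + w x) = F v + F w) \<and>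
     (\<forall>c. \<forall>v\<in>H10_vec \<Omega>. F (\<lambda>x. c *\<^sub>R v x) = c * F v) \<and>
     (\<exists>K. \<forall>v\<in>H10_vec \<Omega>. \<bar>F v\<bar> \<le> K * L2_norm \<Omega> (grad_vec \<Omega> v))}"

definition Hm1_norm :: "(real^'d) set \<Rightarrow> ((real^'d \<Rightarrow> real^'d) \<Rightarrow> real) \<Rightarrow> real" where
  "Hm1_norm \<Omega> F = (SUP v\<in>H10_vec \<Omega>. \<bar>F v\<bar> / L2_norm \<Omega> (grad_vec \<Omega> v))"

text \<open>The functionals on \<open>[H\<^sup>1\<^sub>0(\<Omega>)]\<^sup>d\<close> given by a vector field \<open>g\<close>, and by the distributional
  \<open>-\<nabla>\<cdot>A\<close> of a tensor field \<open>A\<close> (row-wise divergence).\<close>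

definition pairing :: "(real^'d) set \<Rightarrow> (real^'d \<Rightarrow> real^'d) \<Rightarrow> (real^'d \<Rightarrow> real^'d) \<Rightarrow> real" where
  "pairing \<Omega> g v = (LINT x|lebesgue_on \<Omega>. g x \<bullet> v x)"

definition neg_div_pairing ::
  "(real^'d) set \<Rightarrow> (real^'d \<Rightarrow> real^'d^'d) \<Rightarrow> (real^'d \<Rightarrow> real^'d) \<Rightarrow> real" where
  "neg_div_pairing \<Omega> A v = (LINT x|lebesgue_on \<Omega>. A x \<bullet> grad_vec \<Omega> v x)"

definition testable :: "(real^'d) set \<Rightarrow> (real^'d \<Rightarrow> real^'d) \<Rightarrow> bool" where
  "testable \<Omega> g \<longleftrightarrow> (\<forall>v\<in>H10_vec \<Omega>. integrable (lebesgue_on \<Omega>) (\<lambda>x. g x \<bullet> v x))"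

definition neg_div_testable :: "(real^'d) set \<Rightarrow> (real^'d \<Rightarrow> real^'d^'d) \<Rightarrow> bool" where
  "neg_div_testable \<Omega> A \<longleftrightarrow>
     (\<forall>v\<in>H10_vec \<Omega>. integrable (lebesgue_on \<Omega>) (\<lambda>x. A x \<bullet> grad_vec \<Omega> v x))"


section \<open>Boundary: normal, surface measure, traces, integration by parts\<close>

text \<open>\<open>\<nu>\<close> is the outward unit normal at the boundary point \<open>x\<close>: near \<open>x\<close> the domain lies, to first
  order, on the side \<open>\<nu> \<bullet> (y - x) < 0\<close> of the tangent plane and its complement on the other one.\<close>

definition outward_unit_normal :: "'a::euclidean_space set \<Rightarrow> 'a \<Rightarrow> 'a \<Rightarrow> bool" where
  "outward_unit_normal \<Omega> x \<nu> \<longleftrightarrow> norm \<nu> = 1 \<and>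
     (\<forall>e>0. \<exists>\<delta>>0. \<forall>y. norm (y - x) < \<delta> \<longrightarrow>
        (y \<in> \<Omega> \<longrightarrow> \<nu> \<bullet> (y - x) \<le> e * norm (y - x)) \<and>
        (y \<notin> \<Omega> \<longrightarrow> \<nu> \<bullet> (y - x) \<ge> - e * norm (y - x)))"

text \<open>\<open>s\<close>-dimensional Hausdorff measure (\<open>s \<ge> 1\<close>), normalised to agree with surface area. The outer
  measure is a metric outer measure, hence a measure on the Borel sets, so that \<open>measure_of\<close>
  retains its values.\<close>

definition hausdorff_pre :: "nat \<Rightarrow> real \<Rightarrow> 'a::euclidean_space set \<Rightarrow> ennreal" where
  "hausdorff_pre s \<delta> A =
     (INF U\<in>{U::nat \<Rightarrow> 'a set. A \<subseteq> (\<Union>i. U i) \<and> (\<forall>i. bounded (U i) \<and> diameter (U i) \<le> \<delta>)}.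
        (\<Sum>i. ennreal (unit_ball_vol (real s) * (diameter (U i) / 2) ^ s)))"

definition hausdorff_outer :: "nat \<Rightarrow> 'a::euclidean_space set \<Rightarrow> ennreal" where
  "hausdorff_outer s A = (SUP \<delta>\<in>{0<..}. hausdorff_pre s \<delta> A)"

definition hausdorff_measure :: "nat \<Rightarrow> 'a::euclidean_space measure" where
  "hausdorff_measure s = measure_of UNIV (sets borel) (hausdorff_outer s)"

definition surface_measure :: "(real^'d) set \<Rightarrow> (real^'d) measure" where
  "surface_measure \<Omega> = restrict_space (hausdorff_measure (CARD('d) - 1)) (frontier \<Omega>)"

text \<open>Boundary value (trace) of \<open>f\<close> at \<open>x \<in> \<partial>\<Omega>\<close> as limit of averages over \<open>\<Omega> \<inter> B(x,r)\<close>. It does not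
  depend on the almost-everywhere representative, agrees with the limit value when \<open>f\<close> is continuous
  up to the boundary, and with the Sobolev trace on Lipschitz domains.\<close>

definition has_trace :: "(real^'d) set \<Rightarrow> (real^'d \<Rightarrow> real) \<Rightarrow> real^'d \<Rightarrow> real \<Rightarrow> bool" where
  "has_trace \<Omega> f x t \<longleftrightarrow>
     (\<forall>\<^sub>F r in at_right 0. integrable (lebesgue_on (\<Omega> \<inter> ball x r)) f) \<and>
     ((\<lambda>r. (LINT y|lebesgue_on (\<Omega> \<inter> ball x r). \<bar>f y - t\<bar>) / measure lebesgue (\<Omega> \<inter> ball x r))
        \<longlongrightarrow> 0) (at_right 0)"

definition normal_trace_zero ::
  "(real^'d) set \<Rightarrow> (real^'d \<Rightarrow> real^'d) \<Rightarrow> (real^'d \<Rightarrow> real^'d) \<Rightarrow> bool" where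
  "normal_trace_zero \<Omega> \<nu> F \<longleftrightarrow>
     (AE x in surface_measure \<Omega>. has_trace \<Omega> (\<lambda>y. \<nu> x \<bullet> F y) x 0)"

text \<open>\<open>\<nabla>\<cdot>F\<close> may be tested with \<open>q\<close> using integration by parts:
  \<open>\<integral>\<^sub>\<Omega> (\<nabla>\<cdot>F) q + \<integral>\<^sub>\<Omega> F\<cdot>\<nabla>q = \<integral>\<^sub>\<partial>\<^sub>\<Omega> (n\<cdot>F) q\<close>, with boundary values \<open>a\<close> of \<open>n\<cdot>F\<close> and \<open>b\<close> of \<open>q\<close>.\<close>

definition integration_by_parts ::
  "(real^'d) set \<Rightarrow> (real^'d \<Rightarrow> real^'d) \<Rightarrow> (real^'d \<Rightarrow> real^'d) \<Rightarrow> (real^'d \<Rightarrow> real) \<Rightarrow> bool" where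
  "integration_by_parts \<Omega> \<nu> F q \<longleftrightarrow>
     weakly_diff_vec \<Omega> F \<and> weakly_diff \<Omega> q \<and>
     integrable (lebesgue_on \<Omega>) (\<lambda>x. divg \<Omega> F x * q x) \<and>
     integrable (lebesgue_on \<Omega>) (\<lambda>x. F x \<bullet> grad \<Omega> q x) \<and>
     (\<exists>a b. (AE x in surface_measure \<Omega>.
                has_trace \<Omega> (\<lambda>y. \<nu> x \<bullet> F y) x (a x) \<and> has_trace \<Omega> q x (b x)) \<and>
            integrable (surface_measure \<Omega>) (\<lambda>x. a x * b x) \<and>
            (LINT x|lebesgue_on \<Omega>. divg \<Omega> F x * q x) + (LINT x|lebesgue_on \<Omega>. F x \<bullet> grad \<Omega> q x)
              = (LINT x|surface_measure \<Omega>. a x * b x))"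

definition domain_with_normal :: "(real^'d) set \<Rightarrow> (real^'d \<Rightarrow> real^'d) \<Rightarrow> bool" where
  "domain_with_normal \<Omega> \<nu> \<longleftrightarrow> open \<Omega> \<and> connected \<Omega> \<and> \<Omega> \<noteq> {} \<and>
     (AE x in surface_measure \<Omega>. outward_unit_normal \<Omega> x (\<nu> x))"


section \<open>Viscosity\<close>

text \<open>Open space-time cylinder; it differs from \<open>Q\<close> only by a null set.\<close>

definition cylinder :: "(real^'d) set \<Rightarrow> real \<Rightarrow> ((real^'d) \<times> real) set" where
  "cylinder \<Omega> T = \<Omega> \<times> {0<..<T}"

definition space_grad :: "(real^'d) set \<Rightarrow> real \<Rightarrow> ((real^'d) \<times> real \<Rightarrow> real) \<Rightarrow> (real^'d) \<times> real \<Rightarrow> real^'d"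
  where "space_grad \<Omega> T \<mu> z = (\<chi> i. weak_deriv (cylinder \<Omega> T) (axis i 1, 0) \<mu> z)"

definition viscosity :: "(real^'d) set \<Rightarrow> real \<Rightarrow> real \<Rightarrow> ((real^'d) \<times> real \<Rightarrow> real) \<Rightarrow> bool" where
  "viscosity \<Omega> T \<mu>min \<mu> \<longleftrightarrow>
     (AE z in lebesgue_on (cylinder \<Omega> T). \<mu>min \<le> \<mu> z) \<and>
     (\<forall>i. \<exists>g. has_weak_deriv (cylinder \<Omega> T) (axis i 1, 0) \<mu> g) \<and>
     in_Linf (cylinder \<Omega> T) (space_grad \<Omega> T \<mu>)"

definition discrete_viscosity ::
  "(real^'d) set \<Rightarrow> real \<Rightarrow> real \<Rightarrow> ((real^'d) \<times> real \<Rightarrow> real) \<Rightarrow> (real^'d \<Rightarrow> real) \<Rightarrow> bool" where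
  "discrete_viscosity \<Omega> T \<mu>min \<mu> m \<longleftrightarrow> weakly_diff \<Omega> m \<and>
     (AE x in lebesgue_on \<Omega>. \<mu>min \<le> m x \<and>
        norm (grad \<Omega> m x) \<le> Linf_norm (cylinder \<Omega> T) (space_grad \<Omega> T \<mu>))"


section \<open>The fractional-step scheme\<close>

text \<open>In this section \<open>r\<close>, \<open>v\<close>, \<open>p\<close>, \<open>w\<close> stand for \<open>\<rho>\<^sub>n\<close>, \<open>u\<^sub>n\<close>, \<open>p\<^sub>n\<close>, and the end-of-step velocity;
  a prime marks the next time level.\<close>

definition density_step ::
  "(real^'d) set \<Rightarrow> real \<Rightarrow> (real^'d \<Rightarrow> real) \<Rightarrow> (real^'d \<Rightarrow> real) \<Rightarrow> (real^'d \<Rightarrow> real^'d) \<Rightarrow> bool" where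
  "density_step \<Omega> \<tau> r r' w \<longleftrightarrow>
     (AE x in lebesgue_on \<Omega>. (r' x - r x) / \<tau> + w x \<bullet> grad \<Omega> r' x + divg \<Omega> w x / 2 * r' x = 0)"

definition convection ::
  "(real^'d) set \<Rightarrow> (real^'d \<Rightarrow> real) \<Rightarrow> (real^'d \<Rightarrow> real^'d) \<Rightarrow> (real^'d \<Rightarrow> real^'d) \<Rightarrow> real^'d \<Rightarrow> real^'d"
  where
  "convection \<Omega> r v a x =
     (r x *\<^sub>R grad_vec \<Omega> v x) *v a x + (1/2 * divg \<Omega> (\<lambda>y. r y *\<^sub>R a y) x) *\<^sub>R v x"

text \<open>The momentum equation has a source in \<open>[H\<^sup>-\<^sup>1(\<Omega>)]\<^sup>d\<close> and is an equality of functionals on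
  \<open>[H\<^sup>1\<^sub>0(\<Omega>)]\<^sup>d\<close>; the requirement \<open>v' \<in> [H\<^sup>1\<^sub>0(\<Omega>)]\<^sup>d\<close> is the Dirichlet condition.\<close>

definition momentum_step ::
  "(real^'d) set \<Rightarrow> real \<Rightarrow> (real^'d \<Rightarrow> real) \<Rightarrow> ((real^'d \<Rightarrow> real^'d) \<Rightarrow> real) \<Rightarrow>
   (real^'d \<Rightarrow> real) \<Rightarrow> (real^'d \<Rightarrow> real) \<Rightarrow> (real^'d \<Rightarrow> real^'d) \<Rightarrow> (real^'d \<Rightarrow> real^'d) \<Rightarrow>
   (real^'d \<Rightarrow> real) \<Rightarrow> (real^'d \<Rightarrow> real^'d) \<Rightarrow> bool" where
  "momentum_step \<Omega> \<tau> m' f' r r' v v' p w \<longleftrightarrow> v' \<in> H10_vec \<Omega> \<and>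
     (\<forall>\<phi>\<in>H10_vec \<Omega>.
        pairing \<Omega> (\<lambda>x. (r' x / \<tau>) *\<^sub>R v' x + convection \<Omega> r' v' v x) \<phi>
          + neg_div_pairing \<Omega> (\<lambda>x. m' x *\<^sub>R grad_vec \<Omega> v' x) \<phi>
        = pairing \<Omega> (\<lambda>x. (sqrt (r' x * r x) / \<tau>) *\<^sub>R w x - sqrt (r' x / r x) *\<^sub>R grad \<Omega> p x
                       + transpose (grad_vec \<Omega> v x) *v grad \<Omega> m' x) \<phi>
          + f' \<phi>)"

definition pressure_step ::
  "(real^'d) set \<Rightarrow> (real^'d \<Rightarrow> real^'d) \<Rightarrow> real \<Rightarrow> (real^'d \<Rightarrow> real) \<Rightarrow> (real^'d \<Rightarrow> real) \<Rightarrow>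
   (real^'d \<Rightarrow> real^'d) \<Rightarrow> (real^'d \<Rightarrow> real) \<Rightarrow> (real^'d \<Rightarrow> real) \<Rightarrow> bool" where
  "pressure_step \<Omega> \<nu> \<tau> r r' v' p p' \<longleftrightarrow>
     (AE x in lebesgue_on \<Omega>.
        - divg \<Omega> (\<lambda>y. (1 / r' y) *\<^sub>R grad \<Omega> p' y) x
        = - divg \<Omega> (\<lambda>y. (1 / sqrt (r y * r' y)) *\<^sub>R grad \<Omega> p y) x - 1 / \<tau> * divg \<Omega> v' x) \<and>
     normal_trace_zero \<Omega> \<nu>
       (\<lambda>y. (1 / sqrt (r' y)) *\<^sub>R grad \<Omega> p' y - (1 / sqrt (r y)) *\<^sub>R grad \<Omega> p y)"

definition correction_step ::
  "(real^'d) set \<Rightarrow> real \<Rightarrow> (real^'d \<Rightarrow> real) \<Rightarrow> (real^'d \<Rightarrow> real) \<Rightarrow>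
   (real^'d \<Rightarrow> real^'d) \<Rightarrow> (real^'d \<Rightarrow> real) \<Rightarrow> (real^'d \<Rightarrow> real) \<Rightarrow> (real^'d \<Rightarrow> real^'d) \<Rightarrow> bool" where
  "correction_step \<Omega> \<tau> r r' v' p p' w' \<longleftrightarrow>
     (AE x in lebesgue_on \<Omega>.
        w' x = v' x - (\<tau> / sqrt (r' x)) *\<^sub>R
                 ((1 / sqrt (r' x)) *\<^sub>R grad \<Omega> p' x - (1 / sqrt (r x)) *\<^sub>R grad \<Omega> p x))"

text \<open>Smoothness used in one step: all terms of the equations are functions (of the indicated
  integrability), the equations can be tested with \<open>v'\<close>, \<open>p'\<close>, \<open>r' w'\<close> and integrated by parts, and
  the skew-symmetry identity of the convective term holds.\<close>

definition regular_step ::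
  "(real^'d) set \<Rightarrow> (real^'d \<Rightarrow> real^'d) \<Rightarrow> (real^'d \<Rightarrow> real) \<Rightarrow>
   (real^'d \<Rightarrow> real) \<Rightarrow> (real^'d \<Rightarrow> real) \<Rightarrow> (real^'d \<Rightarrow> real^'d) \<Rightarrow> (real^'d \<Rightarrow> real^'d) \<Rightarrow>
   (real^'d \<Rightarrow> real) \<Rightarrow> (real^'d \<Rightarrow> real) \<Rightarrow> (real^'d \<Rightarrow> real^'d) \<Rightarrow> (real^'d \<Rightarrow> real^'d) \<Rightarrow> bool" where
  "regular_step \<Omega> \<nu> m' r r' v v' p p' w w' \<longleftrightarrow>
     weakly_diff \<Omega> r' \<and> weakly_diff_vec \<Omega> w \<and> weakly_diff_vec \<Omega> w' \<and>
     weakly_diff_vec \<Omega> (\<lambda>x. r' x *\<^sub>R v x) \<and> p' \<in> H1 \<Omega> \<and>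
     testable \<Omega> (\<lambda>x. r' x *\<^sub>R v' x) \<and>
     testable \<Omega> (\<lambda>x. (r' x *\<^sub>R grad_vec \<Omega> v' x) *v v x) \<and>
     testable \<Omega> (\<lambda>x. divg \<Omega> (\<lambda>y. r' y *\<^sub>R v y) x *\<^sub>R v' x) \<and>
     neg_div_testable \<Omega> (\<lambda>x. m' x *\<^sub>R grad_vec \<Omega> v' x) \<and>
     testable \<Omega> (\<lambda>x. sqrt (r' x * r x) *\<^sub>R w x) \<and>
     testable \<Omega> (\<lambda>x. sqrt (r' x / r x) *\<^sub>R grad \<Omega> p x) \<and>
     testable \<Omega> (\<lambda>x. transpose (grad_vec \<Omega> v x) *v grad \<Omega> m' x) \<and>
     in_L2 \<Omega> (\<lambda>x. sqrt (r' x) *\<^sub>R w' x) \<and>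
     integration_by_parts \<Omega> \<nu> (\<lambda>x. (1 / r' x) *\<^sub>R grad \<Omega> p' x) p' \<and>
     integration_by_parts \<Omega> \<nu> (\<lambda>x. (1 / sqrt (r x * r' x)) *\<^sub>R grad \<Omega> p x) p' \<and>
     (LINT x|lebesgue_on \<Omega>. convection \<Omega> r' v' v x \<bullet> v' x) = 0"

end

theory Submission
  imports Defs
begin

text \<open>Put $a_n = \sqrt{\rho_n}\,\hat u_n$, $b_n = \sqrt{\rho_n}\,u_n$ and $P_n = \nabla p_n / \sqrt{\rho_n}$.
  The correction step reads $a_{n+1} + \tau P_{n+1} = b_{n+1} + \tau P_n$, and the pressure equation makes
  $a_{n+1}$ orthogonal to $P_{n+1}$. Squaring this relation and testing the momentum equation with
  $2\tau u_{n+1}$ eliminates the pressure and leaves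
  \[ \|a_{n+1}\|^2 + \tau^2\|P_{n+1}\|^2 + \|b_{n+1} - a_n\|^2 + 2\tau\|\sqrt{\mu_{n+1}}\nabla u_{n+1}\|^2
    = \|a_n\|^2 + \tau^2\|P_n\|^2 + 2\tau(g, u_{n+1}) + 2\tau\langle f_{n+1}, u_{n+1}\rangle \]
  with $g = \nabla^\top u_n \nabla\mu_{n+1}$. The term $\|b_{n+1} - a_n\|^2$ pays for replacing $b_{n+1}$ by $a_n$ in the
  bound of $(g, u_{n+1})$, so that the explicit Gronwall argument needs no restriction on $\tau$.\<close>

section \<open>Square-integrable fields and functions vanishing on the boundary\<close>

text \<open>The coupling term pairs the old velocity gradient with the new velocity. A Young
  inequality against \<open>|b|^2\<close> alone, with \<open>b\<close> at the new level, would leave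
  a multiple of \<open>|b|^2\<close> on the right that can be absorbed only for small \<tau>.
  Instead the new level is maximised out pointwise: \<open>2 a.b - |b|^2 + 2 k z |b|\<close> is at
  most \<open>(|a| + k z)^2\<close>, hence at most \<open>(1 + k^2) (|a|^2 + z^2)\<close>, where
  \<open>z\<close> is a scaled norm of the old gradient and \<open>k^2 = \<kappa>\<close>. Thus only
  old energy is multiplied, and \<open>(1 + \<kappa>)^N \<le> exp (N \<kappa>)\<close> is exactly
  the claimed exponential. The old gradient enters through \<open>\<mu>min\<close> and not through
  the viscosity of its time level, so viscosities at consecutive levels are never compared. For
  positive indices the dissipation of the same level dominates it; at index zero the constant
  \<open>C\<close> does. A second obstacle is the boundary: the condition on the pressure carries
  other powers of the density than the fluxes that are integrated by parts, and each integration by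
  parts brings its own boundary values.\<close>

lemma in_L2_imp_integrable_inner:
  fixes f g :: "'a::euclidean_space \<Rightarrow> 'b::euclidean_space"
  assumes "in_L2 S f" "in_L2 S g"
  shows "integrable (lebesgue_on S) (\<lambda>x. f x \<bullet> g x)"
proof (rule Bochner_Integration.integrable_bound)
  show "integrable (lebesgue_on S) (\<lambda>x. (norm (f x))\<^sup>2 + (norm (g x))\<^sup>2)"
    using assms by (simp add: in_L2_def)
  show "(\<lambda>x. f x \<bullet> g x) \<in> borel_measurable (lebesgue_on S)"
    using assms by (auto simp: in_L2_def intro!: borel_measurable_inner)
  have "\<bar>a \<bullet> b\<bar> \<le> (norm a)\<^sup>2 + (norm b)\<^sup>2" for a b :: 'b
    using Cauchy_Schwarz_ineq2[of a b] sum_squares_bound[of "norm a" "norm b"]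
      zero_le_mult_iff[of "norm a" "norm b"] by simp
  then show "AE x in lebesgue_on S. norm (f x \<bullet> g x) \<le> norm ((norm (f x))\<^sup>2 + (norm (g x))\<^sup>2)"
    by (intro AE_I2) simp
qed

lemma L2_norm_nonneg [simp]: "0 \<le> L2_norm S f"
  by (simp add: L2_norm_def)

lemma L2_norm_power2: "(L2_norm S f)\<^sup>2 = (LINT x|lebesgue_on S. f x \<bullet> f x)"
  by (simp add: L2_norm_def power2_norm_eq_inner)

lemma in_L2_add:
  fixes f g :: "'a::euclidean_space \<Rightarrow> 'b::euclidean_space"
  assumes "in_L2 S f" "in_L2 S g"
  shows "in_L2 S (\<lambda>x. f x + g x)"
proof -
  have "integrable (lebesgue_on S) (\<lambda>x. (norm (f x))\<^sup>2 + (norm (g x))\<^sup>2 + 2 * (f x \<bullet> g x))"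
    using assms in_L2_imp_integrable_inner[OF assms] by (simp add: in_L2_def)
  moreover have "(norm (f x + g x))\<^sup>2 = (norm (f x))\<^sup>2 + (norm (g x))\<^sup>2 + 2 * (f x \<bullet> g x)" for x
    by (simp add: power2_norm_eq_inner algebra_simps inner_commute)
  ultimately show ?thesis
    using assms by (simp add: in_L2_def borel_measurable_add)
qed

lemma in_L2_scaleR:
  fixes f :: "'a::euclidean_space \<Rightarrow> 'b::euclidean_space"
  shows "in_L2 S f \<Longrightarrow> in_L2 S (\<lambda>x. c *\<^sub>R f x)"
  by (simp add: in_L2_def power_mult_distrib borel_measurable_scaleR)

lemma in_L2_diff:
  fixes f g :: "'a::euclidean_space \<Rightarrow> 'b::euclidean_space"
  assumes "in_L2 S f" "in_L2 S g"
  shows "in_L2 S (\<lambda>x. f x - g x)"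
  using in_L2_add[OF assms(1) in_L2_scaleR[OF assms(2), of "-1"]] by simp

lemma in_L2_bounded_scaleR:
  fixes f :: "'a::euclidean_space \<Rightarrow> 'b::euclidean_space"
  assumes f: "in_L2 S f" and c: "c \<in> borel_measurable (lebesgue_on S)"
    and K: "AE x in lebesgue_on S. \<bar>c x\<bar> \<le> K"
  shows "in_L2 S (\<lambda>x. c x *\<^sub>R f x)"
  unfolding in_L2_def
proof
  show meas: "(\<lambda>x. c x *\<^sub>R f x) \<in> borel_measurable (lebesgue_on S)"
    using f c by (auto simp: in_L2_def)
  show "integrable (lebesgue_on S) (\<lambda>x. (norm (c x *\<^sub>R f x))\<^sup>2)"
  proof (rule Bochner_Integration.integrable_bound)
    show "integrable (lebesgue_on S) (\<lambda>x. K\<^sup>2 * (norm (f x))\<^sup>2)"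
      using f by (simp add: in_L2_def)
    show "(\<lambda>x. (norm (c x *\<^sub>R f x))\<^sup>2) \<in> borel_measurable (lebesgue_on S)"
      using meas by measurable
    show "AE x in lebesgue_on S. norm ((norm (c x *\<^sub>R f x))\<^sup>2) \<le> norm (K\<^sup>2 * (norm (f x))\<^sup>2)"
      using K
    proof eventually_elim
      case (elim x)
      then have "(\<bar>c x\<bar>)\<^sup>2 \<le> K\<^sup>2" by (intro power_mono) auto
      then show ?case by (simp add: power_mult_distrib mult_right_mono)
    qed
  qed
qed

lemma in_L2_vec_nth:
  fixes f :: "'a::euclidean_space \<Rightarrow> 'b::euclidean_space^'d"
  assumes "in_L2 S f"
  shows "in_L2 S (\<lambda>x. f x $ i)"
  unfolding in_L2_def
proof
  show meas: "(\<lambda>x. f x $ i) \<in> borel_measurable (lebesgue_on S)"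
    using assms unfolding in_L2_def
    by (intro borel_measurable_continuous_on[where f="\<lambda>y. y $ i"] continuous_intros) auto
  show "integrable (lebesgue_on S) (\<lambda>x. (norm (f x $ i))\<^sup>2)"
  proof (rule Bochner_Integration.integrable_bound)
    show "integrable (lebesgue_on S) (\<lambda>x. (norm (f x))\<^sup>2)"
      using assms by (simp add: in_L2_def)
    show "AE x in lebesgue_on S. norm ((norm (f x $ i))\<^sup>2) \<le> norm ((norm (f x))\<^sup>2)"
      by (intro AE_I2) (simp add: power_mono Finite_Cartesian_Product.norm_nth_le)
  qed (use meas in measurable)
qed

text \<open>A vector is the sum of its components placed by the linear, hence continuous, maps
  \<open>axis i\<close>. The component type is general so that the argument serves vector fields
  and, with rows as components, matrix fields.\<close>

lemma borel_measurable_vec: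
  fixes f :: "'a \<Rightarrow> 'b::euclidean_space^'d"
  assumes "\<And>i. (\<lambda>x. f x $ i) \<in> borel_measurable M"
  shows "f \<in> borel_measurable M"
proof -
  have "(\<lambda>x. \<Sum>i\<in>UNIV. axis i (f x $ i)) \<in> borel_measurable M"
  proof (intro borel_measurable_sum)
    fix i
    have "linear (axis i :: 'b \<Rightarrow> 'b^'d)"
      by (auto intro!: linearI simp: axis_def vec_eq_iff)
    then show "(\<lambda>x. axis i (f x $ i)) \<in> borel_measurable M"
      using assms[of i]
      by (intro borel_measurable_continuous_on[where f="axis i"] linear_continuous_on)
        (auto simp: linear_conv_bounded_linear)
  qed
  moreover have "(\<Sum>i\<in>UNIV. axis i (v $ i)) = v" for v :: "'b^'d"
    by (simp add: vec_eq_iff axis_def if_distrib[of "\<lambda>h. _ h"] cong: if_cong)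
  ultimately show ?thesis by simp
qed

lemma in_L2_vec:
  fixes f :: "'a::euclidean_space \<Rightarrow> 'b::euclidean_space^'d"
  assumes "\<And>i. in_L2 S (\<lambda>x. f x $ i)"
  shows "in_L2 S f"
  unfolding in_L2_def
proof
  show "f \<in> borel_measurable (lebesgue_on S)"
    using assms by (intro borel_measurable_vec) (simp add: in_L2_def)
  have "integrable (lebesgue_on S) (\<lambda>x. \<Sum>i\<in>UNIV. (norm (f x $ i))\<^sup>2)"
    using assms by (simp add: in_L2_def)
  moreover have "(norm (f x))\<^sup>2 = (\<Sum>i\<in>UNIV. (norm (f x $ i))\<^sup>2)" for x
    by (simp add: power2_norm_eq_inner inner_vec_def)
  ultimately show "integrable (lebesgue_on S) (\<lambda>x. (norm (f x))\<^sup>2)" by simp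
qed

lemma L2_Cauchy_Schwarz:
  fixes f g :: "'a::euclidean_space \<Rightarrow> 'b::euclidean_space"
  assumes f: "in_L2 S f" and g: "in_L2 S g"
  shows "\<bar>LINT x|lebesgue_on S. f x \<bullet> g x\<bar> \<le> L2_norm S f * L2_norm S g"
proof -
  define A B I where "A = (L2_norm S f)\<^sup>2" and "B = (L2_norm S g)\<^sup>2"
    and "I = (LINT x|lebesgue_on S. f x \<bullet> g x)"
  have quad: "0 \<le> A - 2 * t * I + t\<^sup>2 * B" for t
  proof -
    have "(LINT x|lebesgue_on S. (f x - t *\<^sub>R g x) \<bullet> (f x - t *\<^sub>R g x))
      = (LINT x|lebesgue_on S. f x \<bullet> f x - 2 * t * (f x \<bullet> g x) + t\<^sup>2 * (g x \<bullet> g x))"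
      by (intro Bochner_Integration.integral_cong)
        (auto simp: algebra_simps inner_commute power2_eq_square)
    also have "\<dots> = A - 2 * t * I + t\<^sup>2 * B"
      unfolding A_def B_def I_def L2_norm_power2
      by (subst Bochner_Integration.integral_add Bochner_Integration.integral_diff;
          simp add: in_L2_imp_integrable_inner f g)+
    finally show ?thesis
      by (metis (no_types, lifting) Bochner_Integration.integral_nonneg inner_ge_zero)
  qed
  have "I\<^sup>2 \<le> A * B"
  proof (cases "B = 0")
    case True
    have "I = 0"
    proof (rule ccontr)
      assume "I \<noteq> 0"
      \<comment> \<open>With \<open>B = 0\<close> the quadratic is affine in \<open>t\<close>, and
        this \<open>t\<close> gives it the value -1.\<close>
      then show False using quad[of "(A + 1) / (2 * I)"] True by simp
    qed
    then show ?thesis using True by simp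
  next
    case False
    then have "B > 0" by (simp add: B_def less_le)
    then show ?thesis using quad[of "I / B"] False
      by (simp add: field_simps power2_eq_square)
  qed
  then have "\<bar>I\<bar> \<le> sqrt (A * B)"
    using real_sqrt_le_mono by fastforce
  then show ?thesis
    by (simp add: A_def B_def I_def real_sqrt_mult)
qed

section \<open>Test functions and integration by parts against fields vanishing on the
  boundary\<close>

lemma in_L2_continuous_compact_support:
  fixes f :: "'a::euclidean_space \<Rightarrow> real"
  assumes f: "continuous_on UNIV f" and K: "compact K" "\<And>x. x \<notin> K \<Longrightarrow> f x = 0"
    and S: "S \<in> sets lebesgue"
  shows "in_L2 S f"
  unfolding in_L2_def
proof
  have fb: "f \<in> borel_measurable lebesgue"
    using borel_measurable_continuous_onI[OF f] by (intro measurable_completion) simp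
  then show "f \<in> borel_measurable (lebesgue_on S)"
    by (rule measurable_restrict_space1)
  have "integrable lborel (\<lambda>x. indicator K x *\<^sub>R (f x)\<^sup>2)"
    using K(1) f by (intro borel_integrable_compact) (auto intro!: continuous_intros intro: continuous_on_subset)
  then have "integrable lebesgue (\<lambda>x. indicator K x *\<^sub>R (f x)\<^sup>2)"
    by (simp add: integrable_completion)
  also have "(\<lambda>x. indicator K x *\<^sub>R (f x)\<^sup>2) = (\<lambda>x. (norm (f x))\<^sup>2)"
    using K(2) by (force simp: indicator_def)
  finally show "integrable (lebesgue_on S) (\<lambda>x. (norm (f x))\<^sup>2)"
    using S integrable_mult_indicator[OF S, of "\<lambda>x. (norm (f x))\<^sup>2"]
    by (subst integrable_restrict_space) auto
qed

lemma test_functions_in_L2: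
  assumes "\<phi> \<in> test_functions \<Omega>" "\<Omega> \<in> sets lebesgue"
  shows "in_L2 \<Omega> \<phi>"
proof (rule in_L2_continuous_compact_support[OF _ _ _ assms(2)])
  show "continuous_on UNIV \<phi>"
    using assms by (auto simp: test_functions_def dest: spec[of _ 0])
  show "compact (closure {x. \<phi> x \<noteq> 0})"
    using assms by (simp add: test_functions_def)
  show "\<phi> x = 0" if "x \<notin> closure {x. \<phi> x \<noteq> 0}" for x
    using that closure_subset[of "{x. \<phi> x \<noteq> 0}"] by blast
qed

lemma dir_deriv_test_functions_in_L2:
  assumes \<phi>: "\<phi> \<in> test_functions \<Omega>" and \<Omega>: "\<Omega> \<in> sets lebesgue" and e: "e \<in> Basis"
  shows "in_L2 \<Omega> (dir_deriv e \<phi>)"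
proof (rule in_L2_continuous_compact_support[OF _ _ _ \<Omega>])
  have "cont_diff (Suc 0) \<phi>"
    using \<phi> unfolding test_functions_def by blast
  then show "continuous_on UNIV (dir_deriv e \<phi>)"
    using e by simp
  show "compact (closure {x. \<phi> x \<noteq> 0})"
    using \<phi> by (simp add: test_functions_def)
  fix x assume x: "x \<notin> closure {x. \<phi> x \<noteq> 0}"
  have "((\<lambda>_. 0) has_derivative (\<lambda>_. 0)) (at x)" by simp
  moreover have "open (- closure {x. \<phi> x \<noteq> 0})" "x \<in> - closure {x. \<phi> x \<noteq> 0}"
    using x by auto
  moreover have "0 = \<phi> y" if "y \<in> - closure {x. \<phi> x \<noteq> 0}" for y
    using that closure_subset[of "{x. \<phi> x \<noteq> 0}"] by auto
  ultimately have "(\<phi> has_derivative (\<lambda>_. 0)) (at x)"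
    by (rule has_derivative_transform_within_open)
  then show "dir_deriv e \<phi> x = 0"
    by (simp add: dir_deriv_def frechet_derivative_at[symmetric])
qed

lemma weak_deriv_works:
  assumes "weakly_diff \<Omega> f"
  shows "has_weak_deriv \<Omega> (axis i 1) f (\<lambda>x. grad \<Omega> f x $ i)"
  using assms someI_ex[of "has_weak_deriv \<Omega> (axis i 1) f"]
  by (auto simp: weakly_diff_def grad_def weak_deriv_def)

lemma weakly_diff_measurable:
  assumes "weakly_diff \<Omega> f"
  shows "f \<in> borel_measurable (lebesgue_on \<Omega>)"
  using assms by (auto simp: weakly_diff_def has_weak_deriv_def loc_integrable_def)

lemma weakly_diff_vec_measurable:
  assumes "weakly_diff_vec \<Omega> v"
  shows "v \<in> borel_measurable (lebesgue_on \<Omega>)"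
  using assms by (intro borel_measurable_vec weakly_diff_measurable) (simp add: weakly_diff_vec_def)

text \<open>Strong convergence implies weak convergence, by Cauchy-Schwarz for \<open>q\<close> and
  the error of approximation.\<close>

lemma L2_inner_tendsto:
  fixes g :: "'a::euclidean_space \<Rightarrow> 'b::euclidean_space"
  assumes g: "in_L2 S g" and q: "in_L2 S q" and \<phi>: "\<And>k. in_L2 S (\<phi> k)"
    and lim: "(\<lambda>k. L2_norm S (\<lambda>x. \<phi> k x - g x)) \<longlonglongrightarrow> 0"
  shows "(\<lambda>k. LINT x|lebesgue_on S. q x \<bullet> \<phi> k x) \<longlonglongrightarrow> (LINT x|lebesgue_on S. q x \<bullet> g x)"
proof -
  have "(\<lambda>k. (LINT x|lebesgue_on S. q x \<bullet> \<phi> k x) - (LINT x|lebesgue_on S. q x \<bullet> g x)) \<longlonglongrightarrow> 0"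
  proof (rule Lim_null_comparison)
    show "(\<lambda>k. L2_norm S q * L2_norm S (\<lambda>x. \<phi> k x - g x)) \<longlonglongrightarrow> 0"
      using tendsto_mult[OF tendsto_const lim] by simp
    have "(LINT x|lebesgue_on S. q x \<bullet> \<phi> k x) - (LINT x|lebesgue_on S. q x \<bullet> g x)
        = (LINT x|lebesgue_on S. q x \<bullet> (\<phi> k x - g x))" for k
      using in_L2_imp_integrable_inner[OF q] g \<phi> by (simp add: inner_diff_right)
    then show "\<forall>\<^sub>F k in sequentially. norm ((LINT x|lebesgue_on S. q x \<bullet> \<phi> k x)
        - (LINT x|lebesgue_on S. q x \<bullet> g x)) \<le> L2_norm S q * L2_norm S (\<lambda>x. \<phi> k x - g x)"
      using L2_Cauchy_Schwarz[OF q in_L2_diff[OF \<phi> g]] by simp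
  qed
  then show ?thesis using LIM_zero_iff by blast
qed

lemma L2_norm_vec_nth_le:
  fixes f :: "'a::euclidean_space \<Rightarrow> real^'d"
  assumes "in_L2 S f"
  shows "L2_norm S (\<lambda>x. f x $ i) \<le> L2_norm S f"
  unfolding L2_norm_def
  using assms in_L2_vec_nth[OF assms, of i]
  by (intro real_sqrt_le_mono integral_mono)
    (auto simp: in_L2_def power2_le_iff_abs_le component_le_norm_cart)

text \<open>The weak derivative of \<open>q\<close> is defined by pairing with test functions only.
  The sequence witnessing \<open>f \<in> H10 \<Omega>\<close> converges together with its partial
  derivatives, so the defining identity passes to the limit. No boundary term can arise, whatever
  the shape of the boundary.\<close>

lemma H10_integral_by_parts:
  fixes \<Omega> :: "(real^'d) set"
  assumes \<Omega>: "\<Omega> \<in> sets lebesgue" and f: "f \<in> H10 \<Omega>" and q: "q \<in> H1 \<Omega>"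
  shows "(LINT x|lebesgue_on \<Omega>. q x * grad \<Omega> f x $ i)
       = - (LINT x|lebesgue_on \<Omega>. grad \<Omega> q x $ i * f x)"
proof -
  obtain \<phi> :: "nat \<Rightarrow> real^'d \<Rightarrow> real" where \<phi>: "\<And>k. \<phi> k \<in> test_functions \<Omega>"
    and lim: "(\<lambda>k. L2_norm \<Omega> (\<lambda>x. \<phi> k x - f x)) \<longlonglongrightarrow> 0"
      "(\<lambda>k. L2_norm \<Omega> (\<lambda>x. (\<chi> i. dir_deriv (axis i 1) (\<phi> k) x) - grad \<Omega> f x)) \<longlonglongrightarrow> 0"
    using f unfolding H10_def by blast
  have f': "in_L2 \<Omega> f" "in_L2 \<Omega> (grad \<Omega> f)" and q': "in_L2 \<Omega> q" "in_L2 \<Omega> (grad \<Omega> q)" "weakly_diff \<Omega> q"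
    using f q by (auto simp: H10_def H1_def)
  have d: "in_L2 \<Omega> (dir_deriv (axis i 1) (\<phi> k))" for k i
    using dir_deriv_test_functions_in_L2[OF \<phi> \<Omega>] by simp
  have "in_L2 \<Omega> (\<lambda>x. (\<chi> i. dir_deriv (axis i 1) (\<phi> k) x) - grad \<Omega> f x)" for k
    using d by (intro in_L2_diff f' in_L2_vec) simp
  from L2_norm_vec_nth_le[OF this, where i=i]
  have "(\<lambda>k. L2_norm \<Omega> (\<lambda>x. dir_deriv (axis i 1) (\<phi> k) x - grad \<Omega> f x $ i)) \<longlonglongrightarrow> 0"
    using lim(2) by (intro Lim_null_comparison[OF _ lim(2)]) simp
  from L2_inner_tendsto[OF in_L2_vec_nth[OF f'(2)] q'(1) d this]
  have "(\<lambda>k. LINT x|lebesgue_on \<Omega>. q x * dir_deriv (axis i 1) (\<phi> k) x)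
      \<longlonglongrightarrow> (LINT x|lebesgue_on \<Omega>. q x * grad \<Omega> f x $ i)"
    by simp
  moreover have "(LINT x|lebesgue_on \<Omega>. q x * dir_deriv (axis i 1) (\<phi> k) x)
      = - (LINT x|lebesgue_on \<Omega>. grad \<Omega> q x $ i * \<phi> k x)" for k
    using weak_deriv_works[OF q'(3)] \<phi> by (simp add: has_weak_deriv_def)
  moreover have "(\<lambda>k. - (LINT x|lebesgue_on \<Omega>. grad \<Omega> q x $ i * \<phi> k x))
      \<longlonglongrightarrow> - (LINT x|lebesgue_on \<Omega>. grad \<Omega> q x $ i * f x)"
    using L2_inner_tendsto[OF f'(1) in_L2_vec_nth[OF q'(2)] test_functions_in_L2[OF \<phi> \<Omega>] lim(1)]
    by (intro tendsto_minus) simp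
  ultimately show ?thesis
    using LIMSEQ_unique by simp
qed

lemma H10_vec_in_L2:
  assumes "v \<in> H10_vec \<Omega>"
  shows "in_L2 \<Omega> v" "in_L2 \<Omega> (grad_vec \<Omega> v)"
proof -
  have "in_L2 \<Omega> (\<lambda>x. v x $ i)" "in_L2 \<Omega> (grad \<Omega> (\<lambda>x. v x $ i))" for i
    using assms by (auto simp: H10_vec_def H10_def H1_def)
  then show "in_L2 \<Omega> v" "in_L2 \<Omega> (grad_vec \<Omega> v)"
    by (auto intro!: in_L2_vec[of _ v] in_L2_vec[of _ "grad_vec \<Omega> v"] simp: grad_vec_def)
qed

text \<open>This is the usable form of the Dirichlet condition: it moves the divergence of the new
  velocity onto the pressure, which itself need not vanish on the boundary.\<close>

lemma H10_vec_integral_by_parts: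
  assumes \<Omega>: "\<Omega> \<in> sets lebesgue" and v: "v \<in> H10_vec \<Omega>" and q: "q \<in> H1 \<Omega>"
  shows "integrable (lebesgue_on \<Omega>) (\<lambda>x. divg \<Omega> v x * q x)"
    and "(LINT x|lebesgue_on \<Omega>. divg \<Omega> v x * q x) = - (LINT x|lebesgue_on \<Omega>. v x \<bullet> grad \<Omega> q x)"
proof -
  have div: "divg \<Omega> v x * q x = (\<Sum>i\<in>UNIV. q x * grad \<Omega> (\<lambda>y. v y $ i) x $ i)" for x
    by (simp add: divg_def grad_def sum_distrib_left mult.commute)
  have q': "in_L2 \<Omega> q" "in_L2 \<Omega> (grad \<Omega> q)"
    using q by (auto simp: H1_def)
  have int: "integrable (lebesgue_on \<Omega>) (\<lambda>x. q x * grad \<Omega> (\<lambda>y. v y $ i) x $ i)" for i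
    using in_L2_imp_integrable_inner[OF q'(1) in_L2_vec_nth[OF in_L2_vec_nth[OF H10_vec_in_L2(2)[OF v], of i], of i]]
    by (simp add: grad_vec_def)
  then show "integrable (lebesgue_on \<Omega>) (\<lambda>x. divg \<Omega> v x * q x)"
    unfolding div by simp
  have int2: "integrable (lebesgue_on \<Omega>) (\<lambda>x. grad \<Omega> q x $ i * v x $ i)" for i
    using in_L2_imp_integrable_inner[OF in_L2_vec_nth[OF q'(2)] in_L2_vec_nth[OF H10_vec_in_L2(1)[OF v]]] by simp
  have "(LINT x|lebesgue_on \<Omega>. divg \<Omega> v x * q x)
      = - (\<Sum>i\<in>UNIV. LINT x|lebesgue_on \<Omega>. grad \<Omega> q x $ i * v x $ i)"
    unfolding div using int H10_integral_by_parts[OF \<Omega> _ q] v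
    by (simp add: H10_vec_def sum_negf)
  also have "\<dots> = - (LINT x|lebesgue_on \<Omega>. v x \<bullet> grad \<Omega> q x)"
    using int2 by (simp add: inner_vec_def mult.commute)
  finally show "(LINT x|lebesgue_on \<Omega>. divg \<Omega> v x * q x) = - (LINT x|lebesgue_on \<Omega>. v x \<bullet> grad \<Omega> q x)" .
qed

text \<open>\<open>Hm1_norm\<close> is a supremum of reals, so the quotients must first be bounded;
  the continuity constant in \<open>Hm1_vec\<close> does this.\<close>

lemma Hm1_norm_bound:
  assumes F: "F \<in> Hm1_vec \<Omega>" and v: "v \<in> H10_vec \<Omega>"
  shows "\<bar>F v\<bar> \<le> Hm1_norm \<Omega> F * L2_norm \<Omega> (grad_vec \<Omega> v)"
proof -
  obtain K where K: "\<And>v. v \<in> H10_vec \<Omega> \<Longrightarrow> \<bar>F v\<bar> \<le> K * L2_norm \<Omega> (grad_vec \<Omega> v)"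
    using F unfolding Hm1_vec_def by blast
  \<comment> \<open>The absolute value of \<open>K\<close> is taken because a zero denominator makes
    the quotient 0, while \<open>K\<close> may be negative if all gradient norms vanish.\<close>
  have "\<bar>F w\<bar> / L2_norm \<Omega> (grad_vec \<Omega> w) \<le> \<bar>K\<bar>" if "w \<in> H10_vec \<Omega>" for w
  proof (cases "L2_norm \<Omega> (grad_vec \<Omega> w) = 0")
    case False
    then have "L2_norm \<Omega> (grad_vec \<Omega> w) > 0" by (simp add: less_le)
    then show ?thesis using K[OF that]
      by (simp add: divide_le_eq) (smt (verit) mult_right_mono)
  qed simp
  then have "bdd_above ((\<lambda>v. \<bar>F v\<bar> / L2_norm \<Omega> (grad_vec \<Omega> v)) ` H10_vec \<Omega>)"
    by (auto simp: bdd_above_def)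
  from cSUP_upper[OF v this] have le: "\<bar>F v\<bar> / L2_norm \<Omega> (grad_vec \<Omega> v) \<le> Hm1_norm \<Omega> F"
    by (simp add: Hm1_norm_def)
  show ?thesis
  proof (cases "L2_norm \<Omega> (grad_vec \<Omega> v) = 0")
    \<comment> \<open>The quotient carries no information here; the bound with \<open>K\<close>
      forces \<open>F v = 0\<close> directly.\<close>
    case True
    then show ?thesis using K[OF v] by simp
  next
    case False
    then have "L2_norm \<Omega> (grad_vec \<Omega> v) > 0" by (simp add: less_le)
    then show ?thesis using le by (simp add: divide_le_eq)
  qed
qed

section \<open>Boundary values and the projected velocity\<close>

lemma AE_lebesgue_on_subset:
  assumes "AE x in lebesgue_on S. P x" "S \<in> sets lebesgue" "T \<in> sets lebesgue" "T \<subseteq> S"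
  shows "AE x in lebesgue_on T. P x"
  using assms by (auto simp: AE_restrict_space_iff elim!: eventually_mono)

text \<open>The dominating field \<open>h\<close> allows \<open>f\<close> and \<open>g\<close> to be the two fluxes \<open>\<nabla>p/\<rho>\<close>, whose normal components
  differ by a bounded multiple of the flux with vanishing trace in the boundary condition.\<close>

lemma has_trace_eq:
  fixes \<Omega> :: "(real^'d) set"
  assumes \<Omega>: "open \<Omega>" "x \<in> frontier \<Omega>"
    and f: "has_trace \<Omega> f x s" and g: "has_trace \<Omega> g x t" and h: "has_trace \<Omega> h x 0"
    and le: "AE y in lebesgue_on \<Omega>. \<bar>f y - g y\<bar> \<le> K * \<bar>h y\<bar>"
  shows "s = t"
proof -
  define A where "A r = \<Omega> \<inter> ball x r" for r
  define av where "av k r = (LINT y|lebesgue_on (A r). \<bar>k y\<bar>) / measure lebesgue (A r)" for k r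
  have "((\<lambda>r. av (\<lambda>y. f y - s) r + av (\<lambda>y. g y - t) r + K * av h r) \<longlongrightarrow> 0 + 0 + K * 0) (at_right 0)"
    using f g h unfolding has_trace_def av_def A_def
    by (intro tendsto_add tendsto_mult tendsto_const) auto
  \<comment> \<open>The constant \<open>\<bar>s - t\<bar>\<close> is averaged over
    \<open>A r\<close>. Pointwise it is at most
    \<open>\<bar>f - s\<bar> + \<bar>g - t\<bar> + \<bar>f - g\<bar>\<close>, and the last summand
    is dominated by \<open>K * \<bar>h\<bar>\<close>; all three averages tend to 0.\<close>
  moreover have "\<forall>\<^sub>F r in at_right 0. \<bar>s - t\<bar> \<le> av (\<lambda>y. f y - s) r + av (\<lambda>y. g y - t) r + K * av h r"
  proof -
    have "\<forall>\<^sub>F r in at_right 0. integrable (lebesgue_on (A r)) f"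
      "\<forall>\<^sub>F r in at_right 0. integrable (lebesgue_on (A r)) g"
      "\<forall>\<^sub>F r in at_right 0. integrable (lebesgue_on (A r)) h"
      using f g h by (auto simp: has_trace_def A_def)
    moreover have "\<forall>\<^sub>F r in at_right 0. (0::real) < r"
      by (simp add: eventually_at_filter)
    ultimately show ?thesis
    proof eventually_elim
      case (elim r)
      have A: "A r \<in> lmeasurable"
        unfolding A_def using \<Omega>(1) by (intro bounded_set_imp_lmeasurable) (auto intro: bounded_Int)
      then interpret finite_measure "lebesgue_on (A r)"
        by (rule finite_measure_lebesgue_on)
      \<comment> \<open>A frontier point has points of \<Omega> in every ball around it, so the
        nonempty open set \<open>A r\<close> has positive measure and the averages are genuine
        rather than quotients by zero.\<close>
      have "open (A r)" "A r \<noteq> {}"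
        using \<Omega> elim(4) unfolding A_def frontier_def
        by (auto simp: closure_approachable dist_commute) (metis disjoint_iff mem_ball dist_commute)
      then have pos: "measure lebesgue (A r) > 0"
        using open_not_negligible[of "A r"] A
        by (auto simp: negligible_iff_measure less_le)
      have int: "integrable (lebesgue_on (A r)) (\<lambda>y. \<bar>f y - s\<bar>)"
        "integrable (lebesgue_on (A r)) (\<lambda>y. \<bar>g y - t\<bar>)"
        "integrable (lebesgue_on (A r)) (\<lambda>y. K * \<bar>h y\<bar>)"
        using elim by auto
      have "\<bar>s - t\<bar> * measure lebesgue (A r) = (LINT y|lebesgue_on (A r). \<bar>s - t\<bar>)"
        using A by (simp add: measure_restrict_space)
      also have "\<dots> \<le> (LINT y|lebesgue_on (A r). \<bar>f y - s\<bar> + \<bar>g y - t\<bar> + K * \<bar>h y\<bar>)"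
      proof (rule integral_mono_AE)
        have "AE y in lebesgue_on (A r). \<bar>f y - g y\<bar> \<le> K * \<bar>h y\<bar>"
          using A \<Omega>(1) by (intro AE_lebesgue_on_subset[OF le]) (auto simp: A_def)
        then show "AE y in lebesgue_on (A r). \<bar>s - t\<bar> \<le> \<bar>f y - s\<bar> + \<bar>g y - t\<bar> + K * \<bar>h y\<bar>"
          by eventually_elim linarith
      qed (use int in auto)
      also have "\<dots> = (LINT y|lebesgue_on (A r). \<bar>f y - s\<bar>) + (LINT y|lebesgue_on (A r). \<bar>g y - t\<bar>)
          + K * (LINT y|lebesgue_on (A r). \<bar>h y\<bar>)"
        using int elim by simp
      finally show ?case
        using pos unfolding av_def by (simp add: add_divide_distrib[symmetric] le_divide_eq)
    qed
  qed
  ultimately have "\<bar>s - t\<bar> \<le> 0"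
    by (intro tendsto_lowerbound[where F="at_right (0::real)"]) auto
  then show ?thesis by simp
qed

text \<open>Lets \<open>AE_space\<close> supply the membership in the frontier that
  \<open>has_trace_eq\<close> requires.\<close>

lemma space_surface_measure: "space (surface_measure \<Omega>) = frontier \<Omega>"
  by (simp add: surface_measure_def hausdorff_measure_def space_restrict_space)

text \<open>The correction has the form \<open>w' = v' - \<tau> (F1 - F2)\<close>, so pairing it
  with the gradient of \<open>p'\<close> is the pressure equation tested with \<open>p'\<close>. The
  velocity contributes no boundary term, and those of the two fluxes cancel.\<close>

lemma projected_velocity_orthogonal:
  fixes \<Omega> :: "(real^'d) set"
  assumes \<Omega>: "open \<Omega>" and low: "0 < \<rho>low"
    and r: "AE x in lebesgue_on \<Omega>. \<rho>low \<le> r x" and r': "AE x in lebesgue_on \<Omega>. \<rho>low \<le> r' x"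
    and \<tau>: "\<tau> \<noteq> 0"
    and v': "v' \<in> H10_vec \<Omega>" and p': "p' \<in> H1 \<Omega>"
    and i1: "integration_by_parts \<Omega> \<nu> (\<lambda>x. (1 / r' x) *\<^sub>R grad \<Omega> p' x) p'"
    and i2: "integration_by_parts \<Omega> \<nu> (\<lambda>x. (1 / sqrt (r x * r' x)) *\<^sub>R grad \<Omega> p x) p'"
    and ps: "pressure_step \<Omega> \<nu> \<tau> r r' v' p p'"
    and cs: "correction_step \<Omega> \<tau> r r' v' p p' w'"
    and w': "w' \<in> borel_measurable (lebesgue_on \<Omega>)"
  shows "(LINT x|lebesgue_on \<Omega>. w' x \<bullet> grad \<Omega> p' x) = 0"
proof -
  define F1 where "F1 x = (1 / r' x) *\<^sub>R grad \<Omega> p' x" for x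
  define F2 where "F2 x = (1 / sqrt (r x * r' x)) *\<^sub>R grad \<Omega> p x" for x
  define G where "G x = (1 / sqrt (r' x)) *\<^sub>R grad \<Omega> p' x - (1 / sqrt (r x)) *\<^sub>R grad \<Omega> p x" for x
  have \<Omega>l: "\<Omega> \<in> sets lebesgue" using \<Omega> by simp
  \<comment> \<open>The boundary condition concerns \<open>G\<close>, whereas the integrated fluxes
    differ by \<open>G\<close> divided by \<open>sqrt r'\<close>. The density floor bounds this
    factor by \<open>1 / sqrt \<rho>low\<close>.\<close>
  have FG: "AE x in lebesgue_on \<Omega>. 0 < sqrt \<rho>low \<and> sqrt \<rho>low \<le> sqrt (r' x) \<and>
      F1 x - F2 x = (1 / sqrt (r' x)) *\<^sub>R G x"
    using r r'
  proof eventually_elim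
    case (elim x)
    then have "r' x > 0" "r x > 0" using low by linarith+
    moreover from this have "sqrt (r' x) * sqrt (r' x) = r' x" by simp
    ultimately show ?case using elim low
      by (simp add: F1_def F2_def G_def real_sqrt_mult scaleR_diff_right mult.commute)
  qed
  obtain a1 b1 where ab1: "AE x in surface_measure \<Omega>.
        has_trace \<Omega> (\<lambda>y. \<nu> x \<bullet> F1 y) x (a1 x) \<and> has_trace \<Omega> p' x (b1 x)"
      "integrable (surface_measure \<Omega>) (\<lambda>x. a1 x * b1 x)"
      "(LINT x|lebesgue_on \<Omega>. divg \<Omega> F1 x * p' x) + (LINT x|lebesgue_on \<Omega>. F1 x \<bullet> grad \<Omega> p' x)
        = (LINT x|surface_measure \<Omega>. a1 x * b1 x)"
    using i1 unfolding integration_by_parts_def F1_def by blast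
  obtain a2 b2 where ab2: "AE x in surface_measure \<Omega>.
        has_trace \<Omega> (\<lambda>y. \<nu> x \<bullet> F2 y) x (a2 x) \<and> has_trace \<Omega> p' x (b2 x)"
      "integrable (surface_measure \<Omega>) (\<lambda>x. a2 x * b2 x)"
      "(LINT x|lebesgue_on \<Omega>. divg \<Omega> F2 x * p' x) + (LINT x|lebesgue_on \<Omega>. F2 x \<bullet> grad \<Omega> p' x)
        = (LINT x|surface_measure \<Omega>. a2 x * b2 x)"
    using i2 unfolding integration_by_parts_def F2_def by blast
  have int: "integrable (lebesgue_on \<Omega>) (\<lambda>x. divg \<Omega> F1 x * p' x)"
      "integrable (lebesgue_on \<Omega>) (\<lambda>x. F1 x \<bullet> grad \<Omega> p' x)"
      "integrable (lebesgue_on \<Omega>) (\<lambda>x. divg \<Omega> F2 x * p' x)"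
      "integrable (lebesgue_on \<Omega>) (\<lambda>x. F2 x \<bullet> grad \<Omega> p' x)"
    using i1 i2 unfolding integration_by_parts_def F1_def F2_def by blast+
  have "AE x in surface_measure \<Omega>. has_trace \<Omega> (\<lambda>y. \<nu> x \<bullet> G y) x 0"
    using ps by (simp add: pressure_step_def normal_trace_zero_def G_def)
  \<comment> \<open>The two integrations by parts come with independently chosen boundary values;
    uniqueness of traces identifies them.\<close>
  with ab1(1) ab2(1) AE_space have "AE x in surface_measure \<Omega>. a1 x * b1 x = a2 x * b2 x"
  proof eventually_elim
    case (elim x)
    have x: "x \<in> frontier \<Omega>" using elim by (simp add: space_surface_measure)
    have "AE y in lebesgue_on \<Omega>. \<bar>\<nu> x \<bullet> F1 y - \<nu> x \<bullet> F2 y\<bar> \<le> (1 / sqrt \<rho>low) * \<bar>\<nu> x \<bullet> G y\<bar>"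
      using FG
    proof eventually_elim
      case (elim y)
      then have "\<nu> x \<bullet> F1 y - \<nu> x \<bullet> F2 y = (1 / sqrt (r' y)) * (\<nu> x \<bullet> G y)"
        by (metis inner_diff_right inner_scaleR_right)
      moreover have "1 / sqrt (r' y) \<le> 1 / sqrt \<rho>low"
        using elim by (intro divide_left_mono) auto
      moreover have "0 < sqrt (r' y)" using elim by linarith
      ultimately show ?case
        by (simp only: abs_mult) (intro mult_right_mono, auto)
    qed
    from has_trace_eq[OF \<Omega> x _ _ _ this] have "a1 x = a2 x"
      using elim by blast
    \<comment> \<open>Here \<open>p'\<close> is compared with itself, so \<open>K = 0\<close>
      suffices and \<open>G\<close> merely serves as some field with zero trace.\<close>
    moreover have "b1 x = b2 x"
      using elim by (intro has_trace_eq[OF \<Omega> x, of p' _ p' _ "\<lambda>y. \<nu> x \<bullet> G y" 0]) auto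
    ultimately show ?case by simp
  qed
  then have bd: "(LINT x|surface_measure \<Omega>. a1 x * b1 x) = (LINT x|surface_measure \<Omega>. a2 x * b2 x)"
    using ab1(2) ab2(2) by (intro integral_cong_AE) auto
  have v'p': "integrable (lebesgue_on \<Omega>) (\<lambda>x. divg \<Omega> v' x * p' x)"
    "integrable (lebesgue_on \<Omega>) (\<lambda>x. v' x \<bullet> grad \<Omega> p' x)"
    using H10_vec_integral_by_parts(1)[OF \<Omega>l v' p'] p'
      in_L2_imp_integrable_inner[OF H10_vec_in_L2(1)[OF v']] by (auto simp: H1_def)
  have "(LINT x|lebesgue_on \<Omega>. divg \<Omega> F1 x * p' x) - (LINT x|lebesgue_on \<Omega>. divg \<Omega> F2 x * p' x)
     = (LINT x|lebesgue_on \<Omega>. divg \<Omega> F1 x * p' x - divg \<Omega> F2 x * p' x)"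
    using int by simp
  also have "\<dots> = (LINT x|lebesgue_on \<Omega>. (1 / \<tau>) * (divg \<Omega> v' x * p' x))"
  proof (rule integral_cong_AE)
    have "AE x in lebesgue_on \<Omega>. - divg \<Omega> F1 x = - divg \<Omega> F2 x - 1 / \<tau> * divg \<Omega> v' x"
      using ps unfolding pressure_step_def F1_def F2_def by simp
    then show "AE x in lebesgue_on \<Omega>. divg \<Omega> F1 x * p' x - divg \<Omega> F2 x * p' x
        = (1 / \<tau>) * (divg \<Omega> v' x * p' x)"
    proof eventually_elim
      case (elim x)
      then have "divg \<Omega> F1 x = divg \<Omega> F2 x + 1 / \<tau> * divg \<Omega> v' x" by linarith
      then show ?case by (simp add: algebra_simps)
    qed
  qed (use int v'p' in auto)
  also have "\<dots> = - (1 / \<tau>) * (LINT x|lebesgue_on \<Omega>. v' x \<bullet> grad \<Omega> p' x)"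
    using H10_vec_integral_by_parts(2)[OF \<Omega>l v' p'] by simp
  finally have *: "(LINT x|lebesgue_on \<Omega>. divg \<Omega> F1 x * p' x) - (LINT x|lebesgue_on \<Omega>. divg \<Omega> F2 x * p' x)
      = - (1 / \<tau>) * (LINT x|lebesgue_on \<Omega>. v' x \<bullet> grad \<Omega> p' x)" .
  have "(LINT x|lebesgue_on \<Omega>. w' x \<bullet> grad \<Omega> p' x)
      = (LINT x|lebesgue_on \<Omega>. v' x \<bullet> grad \<Omega> p' x - \<tau> * (F1 x \<bullet> grad \<Omega> p' x - F2 x \<bullet> grad \<Omega> p' x))"
  proof (rule integral_cong_AE)
    have "AE x in lebesgue_on \<Omega>. w' x = v' x - (\<tau> / sqrt (r' x)) *\<^sub>R G x"
      using cs by (simp add: correction_step_def G_def)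
    then show "AE x in lebesgue_on \<Omega>. w' x \<bullet> grad \<Omega> p' x
        = v' x \<bullet> grad \<Omega> p' x - \<tau> * (F1 x \<bullet> grad \<Omega> p' x - F2 x \<bullet> grad \<Omega> p' x)"
      using FG
    proof eventually_elim
      case (elim x)
      have "w' x = v' x - \<tau> *\<^sub>R (F1 x - F2 x)"
        using elim by simp
      then show ?case by (simp add: inner_diff_left)
    qed
    show "(\<lambda>x. w' x \<bullet> grad \<Omega> p' x) \<in> borel_measurable (lebesgue_on \<Omega>)"
      using w' p' by (intro borel_measurable_inner) (auto simp: H1_def in_L2_def)
  qed (use int v'p' in auto)
  also have "\<dots> = (LINT x|lebesgue_on \<Omega>. v' x \<bullet> grad \<Omega> p' x)
      - \<tau> * ((LINT x|lebesgue_on \<Omega>. F1 x \<bullet> grad \<Omega> p' x) - (LINT x|lebesgue_on \<Omega>. F2 x \<bullet> grad \<Omega> p' x))"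
    using int v'p' by simp
  also have "(LINT x|lebesgue_on \<Omega>. F1 x \<bullet> grad \<Omega> p' x) - (LINT x|lebesgue_on \<Omega>. F2 x \<bullet> grad \<Omega> p' x)
      = (1 / \<tau>) * (LINT x|lebesgue_on \<Omega>. v' x \<bullet> grad \<Omega> p' x)"
    using * ab1(3) ab2(3) bd by linarith
  finally show ?thesis using \<tau> by simp
qed

section \<open>Energy balance of one time step\<close>

text \<open>The transpose moves to the other factor, and Cauchy-Schwarz in each row shows that the
  Frobenius norm dominates the operator norm. The constant 1 keeps the final exponent free of
  factors depending on the dimension.\<close>

lemma inner_transpose_matrix_vector_le:
  fixes A :: "real^'n^'m"
  shows "(transpose A *v x) \<bullet> y \<le> norm A * norm x * norm y"
proof -
  have "(norm (A *v y))\<^sup>2 = (\<Sum>i\<in>UNIV. (A $ i \<bullet> y)\<^sup>2)"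
    unfolding power2_norm_eq_inner inner_vec_def[of "A *v y"]
    by (simp add: matrix_vector_mul_component power2_eq_square)
  also have "\<dots> \<le> (\<Sum>i\<in>UNIV. (norm (A $ i))\<^sup>2 * (norm y)\<^sup>2)"
    using Cauchy_Schwarz_ineq by (intro sum_mono) (auto simp: power2_norm_eq_inner)
  also have "\<dots> = (norm A * norm y)\<^sup>2"
    by (simp add: power_mult_distrib sum_distrib_right[symmetric] power2_norm_eq_inner[of A] inner_vec_def[of A A]
        power2_norm_eq_inner[of "A $ _"])
  finally have "norm (A *v y) \<le> norm A * norm y"
    by (rule power2_le_imp_le) simp
  then have "norm x * norm (A *v y) \<le> norm x * (norm A * norm y)"
    by (intro mult_left_mono) auto
  moreover have "(transpose A *v x) \<bullet> y = x \<bullet> (A *v y)"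
    by (simp add: transpose_matrix_vector dot_lmul_matrix)
  ultimately show ?thesis
    using norm_cauchy_schwarz[of x "A *v y"] by (simp add: mult.left_commute mult.assoc)
qed

text \<open>At a point of \<Omega>, \<open>a\<close> and \<open>b\<close> become the
  density-weighted old end-of-step velocity and new velocity, and \<open>z\<close> the scaled norm
  of the old gradient. There is no smallness condition on \<open>k\<close>.\<close>

lemma absorb_coupling:
  fixes a b :: "'a::real_inner" and z k :: real
  shows "2 * (a \<bullet> b) - b \<bullet> b + 2 * (k * z) * norm b \<le> (1 + k\<^sup>2) * (a \<bullet> a + z\<^sup>2)"
proof -
  have "2 * (a \<bullet> b) - b \<bullet> b + 2 * (k * z) * norm b
      \<le> 2 * norm a * norm b - (norm b)\<^sup>2 + 2 * (k * z) * norm b"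
    using norm_cauchy_schwarz[of a b] by (simp add: power2_norm_eq_inner)
  also have "\<dots> \<le> (1 + k\<^sup>2) * ((norm a)\<^sup>2 + z\<^sup>2)"
  proof -
    \<comment> \<open>The first square measures the distance of \<open>norm b\<close> from the
      maximiser; the second is the defect in Cauchy-Schwarz for the pairs \<open>(norm a, z)\<close>
      and \<open>(1, k)\<close>.\<close>
    have "0 \<le> (norm b - (norm a + k * z))\<^sup>2 + (k * norm a - z)\<^sup>2" by simp
    then show ?thesis by (simp add: power2_eq_square algebra_simps)
  qed
  finally show ?thesis by (simp add: power2_norm_eq_inner)
qed

lemma in_L2_inverse_sqrt_scaleR:
  fixes g :: "'a::euclidean_space \<Rightarrow> 'b::euclidean_space"
  assumes g: "in_L2 S g" and r: "r \<in> borel_measurable (lebesgue_on S)"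
    and low: "0 < \<rho>low" "AE x in lebesgue_on S. \<rho>low \<le> r x"
  shows "in_L2 S (\<lambda>x. (1 / sqrt (r x)) *\<^sub>R g x)"
proof (rule in_L2_bounded_scaleR[OF g])
  show "(\<lambda>x. 1 / sqrt (r x)) \<in> borel_measurable (lebesgue_on S)"
    using r by measurable
  show "AE x in lebesgue_on S. \<bar>1 / sqrt (r x)\<bar> \<le> 1 / sqrt \<rho>low"
    using low(2)
  proof eventually_elim
    case (elim x)
    then have "r x > 0" using low(1) by linarith
    then show ?case using elim low(1) by (simp add: frac_le)
  qed
qed

text \<open>The square-root weights of the scheme turn every mass and pressure term into an inner
  product of the weighted fields, and skew-symmetry removes convection. The test function is
  \<open>v'\<close> and the balance is multiplied by \<tau>; it is doubled only when joined with the
  squared correction relation.\<close>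

lemma momentum_energy:
  fixes \<Omega> :: "(real^'d) set"
  assumes low: "0 < \<rho>low"
    and r: "AE x in lebesgue_on \<Omega>. \<rho>low \<le> r x" and r': "AE x in lebesgue_on \<Omega>. \<rho>low \<le> r' x"
    and \<tau>: "0 < \<tau>"
    and reg: "regular_step \<Omega> \<nu> m' r r' v v' p p' w w'"
    and mom: "momentum_step \<Omega> \<tau> m' f' r r' v v' p w"
    and a: "in_L2 \<Omega> (\<lambda>x. sqrt (r x) *\<^sub>R w x)"
    and P: "in_L2 \<Omega> (\<lambda>x. (1 / sqrt (r x)) *\<^sub>R grad \<Omega> p x)"
    and b: "in_L2 \<Omega> (\<lambda>x. sqrt (r' x) *\<^sub>R v' x)"
  shows "(LINT x|lebesgue_on \<Omega>. (sqrt (r' x) *\<^sub>R v' x) \<bullet> (sqrt (r' x) *\<^sub>R v' x))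
     + \<tau> * (LINT x|lebesgue_on \<Omega>. (m' x *\<^sub>R grad_vec \<Omega> v' x) \<bullet> grad_vec \<Omega> v' x)
   = (LINT x|lebesgue_on \<Omega>. (sqrt (r x) *\<^sub>R w x) \<bullet> (sqrt (r' x) *\<^sub>R v' x))
     - \<tau> * (LINT x|lebesgue_on \<Omega>. ((1 / sqrt (r x)) *\<^sub>R grad \<Omega> p x) \<bullet> (sqrt (r' x) *\<^sub>R v' x))
     + \<tau> * (LINT x|lebesgue_on \<Omega>. (transpose (grad_vec \<Omega> v x) *v grad \<Omega> m' x) \<bullet> v' x)
     + \<tau> * f' v'"
proof -
  have v': "v' \<in> H10_vec \<Omega>" using mom by (simp add: momentum_step_def)
  let ?g = "\<lambda>x. transpose (grad_vec \<Omega> v x) *v grad \<Omega> m' x"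
  have pos: "AE x in lebesgue_on \<Omega>. 0 < r x \<and> 0 < r' x"
    using r r' low by (auto elim!: eventually_elim2)
  \<comment> \<open>A pairing is a Bochner integral, so it splits into its terms only once each of
    them is known to be integrable.\<close>
  have int: "integrable (lebesgue_on \<Omega>) (\<lambda>x. (r' x *\<^sub>R v' x) \<bullet> v' x)"
    "integrable (lebesgue_on \<Omega>) (\<lambda>x. ((r' x *\<^sub>R grad_vec \<Omega> v' x) *v v x) \<bullet> v' x)"
    "integrable (lebesgue_on \<Omega>) (\<lambda>x. (divg \<Omega> (\<lambda>y. r' y *\<^sub>R v y) x *\<^sub>R v' x) \<bullet> v' x)"
    "integrable (lebesgue_on \<Omega>) (\<lambda>x. (sqrt (r' x * r x) *\<^sub>R w x) \<bullet> v' x)"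
    "integrable (lebesgue_on \<Omega>) (\<lambda>x. (sqrt (r' x / r x) *\<^sub>R grad \<Omega> p x) \<bullet> v' x)"
    "integrable (lebesgue_on \<Omega>) (\<lambda>x. ?g x \<bullet> v' x)"
    using reg v' by (simp_all add: regular_step_def testable_def del: inner_scaleR_left)
  have conv: "convection \<Omega> r' v' v x \<bullet> v' x = ((r' x *\<^sub>R grad_vec \<Omega> v' x) *v v x) \<bullet> v' x
      + 1/2 * ((divg \<Omega> (\<lambda>y. r' y *\<^sub>R v y) x *\<^sub>R v' x) \<bullet> v' x)" for x
    by (simp add: convection_def inner_add_left)
  have iconv: "integrable (lebesgue_on \<Omega>) (\<lambda>x. convection \<Omega> r' v' v x \<bullet> v' x)"
    unfolding conv using int(2,3) by (intro Bochner_Integration.integrable_add integrable_mult_right)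
  have skew: "(LINT x|lebesgue_on \<Omega>. convection \<Omega> r' v' v x \<bullet> v' x) = 0"
    using reg by (simp add: regular_step_def)
  have "pairing \<Omega> (\<lambda>x. (r' x / \<tau>) *\<^sub>R v' x + convection \<Omega> r' v' v x) v'
     = (LINT x|lebesgue_on \<Omega>. (1 / \<tau>) * ((r' x *\<^sub>R v' x) \<bullet> v' x) + convection \<Omega> r' v' v x \<bullet> v' x)"
    unfolding pairing_def by (simp add: inner_add_left)
  also have "\<dots> = (1 / \<tau>) * (LINT x|lebesgue_on \<Omega>. (r' x *\<^sub>R v' x) \<bullet> v' x)"
    using skew by (subst Bochner_Integration.integral_add[OF integrable_mult_right[OF int(1)] iconv]) simp
  finally have L: "pairing \<Omega> (\<lambda>x. (r' x / \<tau>) *\<^sub>R v' x + convection \<Omega> r' v' v x) v'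
     = (1 / \<tau>) * (LINT x|lebesgue_on \<Omega>. (r' x *\<^sub>R v' x) \<bullet> v' x)" .
  have "pairing \<Omega> (\<lambda>x. (sqrt (r' x * r x) / \<tau>) *\<^sub>R w x - sqrt (r' x / r x) *\<^sub>R grad \<Omega> p x + ?g x) v'
     = (LINT x|lebesgue_on \<Omega>. (1 / \<tau>) * ((sqrt (r' x * r x) *\<^sub>R w x) \<bullet> v' x)
          - (sqrt (r' x / r x) *\<^sub>R grad \<Omega> p x) \<bullet> v' x + ?g x \<bullet> v' x)"
    unfolding pairing_def by (simp add: inner_add_left inner_diff_left)
  also have "\<dots> = (1 / \<tau>) * (LINT x|lebesgue_on \<Omega>. (sqrt (r' x * r x) *\<^sub>R w x) \<bullet> v' x)
      - (LINT x|lebesgue_on \<Omega>. (sqrt (r' x / r x) *\<^sub>R grad \<Omega> p x) \<bullet> v' x)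
      + (LINT x|lebesgue_on \<Omega>. ?g x \<bullet> v' x)"
    by (subst Bochner_Integration.integral_add
        [OF Bochner_Integration.integrable_diff[OF integrable_mult_right[OF int(4)] int(5)] int(6)],
      subst Bochner_Integration.integral_diff[OF integrable_mult_right[OF int(4)] int(5)],
      subst integral_mult_right_zero) (rule refl)
  finally have R: "pairing \<Omega> (\<lambda>x. (sqrt (r' x * r x) / \<tau>) *\<^sub>R w x
        - sqrt (r' x / r x) *\<^sub>R grad \<Omega> p x + ?g x) v'
     = (1 / \<tau>) * (LINT x|lebesgue_on \<Omega>. (sqrt (r' x * r x) *\<^sub>R w x) \<bullet> v' x)
      - (LINT x|lebesgue_on \<Omega>. (sqrt (r' x / r x) *\<^sub>R grad \<Omega> p x) \<bullet> v' x)
      + (LINT x|lebesgue_on \<Omega>. ?g x \<bullet> v' x)" .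
  have e1: "(LINT x|lebesgue_on \<Omega>. (r' x *\<^sub>R v' x) \<bullet> v' x)
      = (LINT x|lebesgue_on \<Omega>. (sqrt (r' x) *\<^sub>R v' x) \<bullet> (sqrt (r' x) *\<^sub>R v' x))"
  proof (rule integral_cong_AE)
    show "AE x in lebesgue_on \<Omega>. (r' x *\<^sub>R v' x) \<bullet> v' x
        = (sqrt (r' x) *\<^sub>R v' x) \<bullet> (sqrt (r' x) *\<^sub>R v' x)"
      using pos by eventually_elim simp
  qed (use int(1) in_L2_imp_integrable_inner[OF b b] in \<open>blast dest: borel_measurable_integrable\<close>)+
  \<comment> \<open>Unlike \<open>e1\<close>, where the square of \<open>sqrt (r' x)\<close> is
    \<open>r' x\<close> only for nonnegative density, \<open>e2\<close> and \<open>e3\<close> hold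
    at every point: \<open>sqrt\<close> is multiplicative on all reals.\<close>
  have e2: "(LINT x|lebesgue_on \<Omega>. (sqrt (r' x * r x) *\<^sub>R w x) \<bullet> v' x)
      = (LINT x|lebesgue_on \<Omega>. (sqrt (r x) *\<^sub>R w x) \<bullet> (sqrt (r' x) *\<^sub>R v' x))"
    by (simp add: real_sqrt_mult mult_ac)
  have e3: "(LINT x|lebesgue_on \<Omega>. (sqrt (r' x / r x) *\<^sub>R grad \<Omega> p x) \<bullet> v' x)
      = (LINT x|lebesgue_on \<Omega>. ((1 / sqrt (r x)) *\<^sub>R grad \<Omega> p x) \<bullet> (sqrt (r' x) *\<^sub>R v' x))"
    by (simp add: real_sqrt_divide mult_ac)
  have "pairing \<Omega> (\<lambda>x. (r' x / \<tau>) *\<^sub>R v' x + convection \<Omega> r' v' v x) v'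
      + neg_div_pairing \<Omega> (\<lambda>x. m' x *\<^sub>R grad_vec \<Omega> v' x) v'
    = pairing \<Omega> (\<lambda>x. (sqrt (r' x * r x) / \<tau>) *\<^sub>R w x
        - sqrt (r' x / r x) *\<^sub>R grad \<Omega> p x + ?g x) v' + f' v'"
    using mom v' unfolding momentum_step_def by blast
  then have "\<tau> * ((1 / \<tau>) * (LINT x|lebesgue_on \<Omega>. (r' x *\<^sub>R v' x) \<bullet> v' x)
      + neg_div_pairing \<Omega> (\<lambda>x. m' x *\<^sub>R grad_vec \<Omega> v' x) v')
    = \<tau> * ((1 / \<tau>) * (LINT x|lebesgue_on \<Omega>. (sqrt (r' x * r x) *\<^sub>R w x) \<bullet> v' x)
      - (LINT x|lebesgue_on \<Omega>. (sqrt (r' x / r x) *\<^sub>R grad \<Omega> p x) \<bullet> v' x)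
      + (LINT x|lebesgue_on \<Omega>. ?g x \<bullet> v' x) + f' v')"
    unfolding L R by simp
  then show ?thesis
    unfolding e1 e2 e3 using \<tau> by (simp only: distrib_left right_diff_distrib neg_div_pairing_def) simp
qed

text \<open>Twice the momentum balance is added to the squared correction relation, and the mixed
  terms of old pressure and new velocity cancel. The growth factor falls on the old velocity and
  gradient only; the pressure term passes with factor 1.\<close>

lemma step_energy:
  fixes \<Omega> :: "(real^'d) set"
  assumes \<Omega>: "open \<Omega>" and low: "0 < \<rho>low" and \<mu>min: "0 < \<mu>min" and \<epsilon>v: "0 < \<epsilon>v" and \<tau>: "0 < \<tau>"
    and r: "AE x in lebesgue_on \<Omega>. \<rho>low \<le> r x" and r': "AE x in lebesgue_on \<Omega>. \<rho>low \<le> r' x"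
    and m': "discrete_viscosity \<Omega> T \<mu>min \<mu> m'"
    and v: "v \<in> H10_vec \<Omega>"
    and a: "in_L2 \<Omega> (\<lambda>x. sqrt (r x) *\<^sub>R w x)"
    and P: "in_L2 \<Omega> (\<lambda>x. (1 / sqrt (r x)) *\<^sub>R grad \<Omega> p x)"
    and reg: "regular_step \<Omega> \<nu> m' r r' v v' p p' w w'"
    and mom: "momentum_step \<Omega> \<tau> m' f' r r' v v' p w"
    and ps: "pressure_step \<Omega> \<nu> \<tau> r r' v' p p'"
    and cs: "correction_step \<Omega> \<tau> r r' v' p p' w'"
    and \<kappa>: "\<kappa> = \<tau> * (Linf_norm (cylinder \<Omega> T) (space_grad \<Omega> T \<mu>))\<^sup>2 / (\<epsilon>v * \<rho>low * \<mu>min)"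
  shows "(L2_norm \<Omega> (\<lambda>x. sqrt (r' x) *\<^sub>R w' x))\<^sup>2
       + \<tau>\<^sup>2 * (L2_norm \<Omega> (\<lambda>x. (1 / sqrt (r' x)) *\<^sub>R grad \<Omega> p' x))\<^sup>2
       + 2 * \<tau> * (L2_norm \<Omega> (\<lambda>x. sqrt (m' x) *\<^sub>R grad_vec \<Omega> v' x))\<^sup>2
     \<le> (1 + \<kappa>) * ((L2_norm \<Omega> (\<lambda>x. sqrt (r x) *\<^sub>R w x))\<^sup>2 + \<tau> * \<epsilon>v * \<mu>min * (L2_norm \<Omega> (grad_vec \<Omega> v))\<^sup>2)
       + \<tau>\<^sup>2 * (L2_norm \<Omega> (\<lambda>x. (1 / sqrt (r x)) *\<^sub>R grad \<Omega> p x))\<^sup>2 + 2 * \<tau> * f' v'"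
    and "\<mu>min * (L2_norm \<Omega> (grad_vec \<Omega> v'))\<^sup>2 \<le> (L2_norm \<Omega> (\<lambda>x. sqrt (m' x) *\<^sub>R grad_vec \<Omega> v' x))\<^sup>2"
proof -
  define L where "L = Linf_norm (cylinder \<Omega> T) (space_grad \<Omega> T \<mu>)"
  let ?a = "\<lambda>x. sqrt (r x) *\<^sub>R w x" and ?a' = "\<lambda>x. sqrt (r' x) *\<^sub>R w' x"
  let ?P = "\<lambda>x. (1 / sqrt (r x)) *\<^sub>R grad \<Omega> p x" and ?P' = "\<lambda>x. (1 / sqrt (r' x)) *\<^sub>R grad \<Omega> p' x"
  let ?b = "\<lambda>x. sqrt (r' x) *\<^sub>R v' x"
  let ?g = "\<lambda>x. transpose (grad_vec \<Omega> v x) *v grad \<Omega> m' x"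
  have v': "v' \<in> H10_vec \<Omega>" using mom by (simp add: momentum_step_def)
  have pos: "AE x in lebesgue_on \<Omega>. 0 < r x \<and> 0 < r' x \<and> \<rho>low \<le> r' x"
    using r r' low by (auto elim!: eventually_elim2)
  have r'meas: "r' \<in> borel_measurable (lebesgue_on \<Omega>)" and m'meas: "m' \<in> borel_measurable (lebesgue_on \<Omega>)"
    using reg m' by (auto simp: regular_step_def discrete_viscosity_def intro: weakly_diff_measurable)
  have w': "w' \<in> borel_measurable (lebesgue_on \<Omega>)"
    using reg by (auto simp: regular_step_def intro: weakly_diff_vec_measurable)
  have a': "in_L2 \<Omega> ?a'" and p': "p' \<in> H1 \<Omega>" using reg by (auto simp: regular_step_def)
  then have gp': "in_L2 \<Omega> (grad \<Omega> p')" by (simp add: H1_def)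
  have P': "in_L2 \<Omega> ?P'" by (rule in_L2_inverse_sqrt_scaleR[OF gp' r'meas low r'])
  have correction: "AE x in lebesgue_on \<Omega>. ?a' x + \<tau> *\<^sub>R ?P' x = ?b x + \<tau> *\<^sub>R ?P x \<and> ?a' x \<bullet> ?P' x = w' x \<bullet> grad \<Omega> p' x"
    using cs pos unfolding correction_step_def
  proof eventually_elim
    case (elim x)
    then have s: "sqrt (r' x) \<noteq> 0" by simp
    have "sqrt (r' x) *\<^sub>R (v' x - (\<tau> / sqrt (r' x)) *\<^sub>R q) = ?b x - \<tau> *\<^sub>R q" for q
      using s by (simp add: scaleR_diff_right)
    then have "?a' x = ?b x - \<tau> *\<^sub>R (?P' x - ?P x)"
      unfolding elim(1) .
    then have "?a' x + \<tau> *\<^sub>R ?P' x = ?b x + \<tau> *\<^sub>R ?P x"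
      by (simp add: scaleR_diff_right)
    moreover have "?a' x \<bullet> ?P' x = w' x \<bullet> grad \<Omega> p' x"
      using s by simp
    ultimately show ?case ..
  qed
  have b: "in_L2 \<Omega> ?b"
  proof -
    have bm: "?b \<in> borel_measurable (lebesgue_on \<Omega>)"
      using r'meas H10_vec_in_L2(1)[OF v'] by (auto simp: in_L2_def intro!: borel_measurable_scaleR)
    \<comment> \<open>The weight \<open>sqrt (r' x)\<close> has no upper bound here, so membership
      is not inherited from \<open>v'\<close> but read off from the correction relation, whose other
      terms are square integrable.\<close>
    have "in_L2 \<Omega> (\<lambda>x. ?a' x + \<tau> *\<^sub>R ?P' x - \<tau> *\<^sub>R ?P x)"
      by (intro in_L2_add in_L2_diff in_L2_scaleR a' P P')
    then have "integrable (lebesgue_on \<Omega>) (\<lambda>x. (norm (?a' x + \<tau> *\<^sub>R ?P' x - \<tau> *\<^sub>R ?P x))\<^sup>2)"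
      by (simp only: in_L2_def)
    moreover have "(\<lambda>x. (norm (?b x))\<^sup>2) \<in> borel_measurable (lebesgue_on \<Omega>)"
      using bm by measurable
    moreover have "AE x in lebesgue_on \<Omega>. (norm (?a' x + \<tau> *\<^sub>R ?P' x - \<tau> *\<^sub>R ?P x))\<^sup>2 = (norm (?b x))\<^sup>2"
      using correction by eventually_elim simp
    ultimately have "integrable (lebesgue_on \<Omega>) (\<lambda>x. (norm (?b x))\<^sup>2)"
      by (rule integrable_cong_AE_imp)
    with bm show ?thesis by (simp only: in_L2_def)
  qed
  note int = in_L2_imp_integrable_inner
  have orth: "(LINT x|lebesgue_on \<Omega>. ?a' x \<bullet> ?P' x) = 0"
  proof -
    have "(LINT x|lebesgue_on \<Omega>. ?a' x \<bullet> ?P' x) = (LINT x|lebesgue_on \<Omega>. w' x \<bullet> grad \<Omega> p' x)"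
    proof (rule integral_cong_AE)
      show "AE x in lebesgue_on \<Omega>. ?a' x \<bullet> ?P' x = w' x \<bullet> grad \<Omega> p' x"
        using correction by eventually_elim blast
      show "(\<lambda>x. w' x \<bullet> grad \<Omega> p' x) \<in> borel_measurable (lebesgue_on \<Omega>)"
        using w' gp' by (auto simp: in_L2_def intro: borel_measurable_inner)
    qed (use int[OF a' P'] in \<open>blast dest: borel_measurable_integrable\<close>)
    also have "\<dots> = 0"
      using reg \<tau> by (intro projected_velocity_orthogonal[OF \<Omega> low r r' _ v' p' _ _ ps cs w'])
        (auto simp: regular_step_def)
    finally show ?thesis .
  qed
  \<comment> \<open>Both sides of the correction relation are squared. The mixed term on the left
    vanishes by \<open>orth\<close>; the one on the right is kept for cancellation.\<close>
  have "(LINT x|lebesgue_on \<Omega>. ?a' x \<bullet> ?a' x + \<tau>\<^sup>2 * (?P' x \<bullet> ?P' x) + 2 * \<tau> * (?a' x \<bullet> ?P' x))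
      = (LINT x|lebesgue_on \<Omega>. ?b x \<bullet> ?b x + \<tau>\<^sup>2 * (?P x \<bullet> ?P x) + 2 * \<tau> * (?P x \<bullet> ?b x))"
  proof (rule integral_cong_AE)
    have sq: "(s + \<tau> *\<^sub>R t) \<bullet> (s + \<tau> *\<^sub>R t) = s \<bullet> s + \<tau>\<^sup>2 * (t \<bullet> t) + 2 * \<tau> * (s \<bullet> t)" for s t :: "real^'d"
      by (simp add: inner_add_left inner_add_right inner_commute power2_eq_square)
    show "AE x in lebesgue_on \<Omega>. ?a' x \<bullet> ?a' x + \<tau>\<^sup>2 * (?P' x \<bullet> ?P' x) + 2 * \<tau> * (?a' x \<bullet> ?P' x)
       = ?b x \<bullet> ?b x + \<tau>\<^sup>2 * (?P x \<bullet> ?P x) + 2 * \<tau> * (?P x \<bullet> ?b x)"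
      using correction by eventually_elim (metis sq inner_commute)
  qed (intro borel_measurable_integrable Bochner_Integration.integrable_add integrable_mult_right int a' P' P b)+
  also have "(LINT x|lebesgue_on \<Omega>. ?a' x \<bullet> ?a' x + \<tau>\<^sup>2 * (?P' x \<bullet> ?P' x) + 2 * \<tau> * (?a' x \<bullet> ?P' x))
      = (LINT x|lebesgue_on \<Omega>. ?a' x \<bullet> ?a' x) + \<tau>\<^sup>2 * (LINT x|lebesgue_on \<Omega>. ?P' x \<bullet> ?P' x)
        + 2 * \<tau> * (LINT x|lebesgue_on \<Omega>. ?a' x \<bullet> ?P' x)"
    by (subst Bochner_Integration.integral_add integral_mult_right_zero;
        (intro Bochner_Integration.integrable_add integrable_mult_right int a' P')?)+ (rule refl)
  also have "(LINT x|lebesgue_on \<Omega>. ?b x \<bullet> ?b x + \<tau>\<^sup>2 * (?P x \<bullet> ?P x) + 2 * \<tau> * (?P x \<bullet> ?b x))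
      = (LINT x|lebesgue_on \<Omega>. ?b x \<bullet> ?b x) + \<tau>\<^sup>2 * (LINT x|lebesgue_on \<Omega>. ?P x \<bullet> ?P x)
        + 2 * \<tau> * (LINT x|lebesgue_on \<Omega>. ?P x \<bullet> ?b x)"
    by (subst Bochner_Integration.integral_add integral_mult_right_zero;
        (intro Bochner_Integration.integrable_add integrable_mult_right int P b)?)+ (rule refl)
  finally have proj: "(L2_norm \<Omega> ?a')\<^sup>2 + \<tau>\<^sup>2 * (L2_norm \<Omega> ?P')\<^sup>2
      = (L2_norm \<Omega> ?b)\<^sup>2 + \<tau>\<^sup>2 * (L2_norm \<Omega> ?P)\<^sup>2 + 2 * \<tau> * (LINT x|lebesgue_on \<Omega>. ?P x \<bullet> ?b x)"
    unfolding orth L2_norm_power2 by simp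
  have intD: "integrable (lebesgue_on \<Omega>) (\<lambda>x. (m' x *\<^sub>R grad_vec \<Omega> v' x) \<bullet> grad_vec \<Omega> v' x)"
    using reg v' by (simp add: regular_step_def neg_div_testable_def del: inner_scaleR_left)
  have visc: "AE x in lebesgue_on \<Omega>. \<mu>min \<le> m' x \<and> norm (grad \<Omega> m' x) \<le> L"
    using m' by (simp add: discrete_viscosity_def L_def)
  have dissip: "(L2_norm \<Omega> (\<lambda>x. sqrt (m' x) *\<^sub>R grad_vec \<Omega> v' x))\<^sup>2
      = (LINT x|lebesgue_on \<Omega>. (m' x *\<^sub>R grad_vec \<Omega> v' x) \<bullet> grad_vec \<Omega> v' x)"
    unfolding L2_norm_power2
  proof (rule integral_cong_AE)
    show "AE x in lebesgue_on \<Omega>. (sqrt (m' x) *\<^sub>R grad_vec \<Omega> v' x) \<bullet> (sqrt (m' x) *\<^sub>R grad_vec \<Omega> v' x)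
        = (m' x *\<^sub>R grad_vec \<Omega> v' x) \<bullet> grad_vec \<Omega> v' x"
      using visc
    proof eventually_elim
      case (elim x)
      then have "sqrt (m' x) * sqrt (m' x) = m' x" using \<mu>min by simp
      then show ?case by (metis inner_scaleR_left inner_scaleR_right mult.assoc)
    qed
    show "(\<lambda>x. (sqrt (m' x) *\<^sub>R grad_vec \<Omega> v' x) \<bullet> (sqrt (m' x) *\<^sub>R grad_vec \<Omega> v' x))
        \<in> borel_measurable (lebesgue_on \<Omega>)"
      using m'meas H10_vec_in_L2(2)[OF v']
      by (intro borel_measurable_inner borel_measurable_scaleR) (auto simp: in_L2_def)
  qed (use intD in \<open>blast dest: borel_measurable_integrable\<close>)
  have gv': "integrable (lebesgue_on \<Omega>) (\<lambda>x. grad_vec \<Omega> v' x \<bullet> grad_vec \<Omega> v' x)"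
    by (intro int H10_vec_in_L2 v')
  show "\<mu>min * (L2_norm \<Omega> (grad_vec \<Omega> v'))\<^sup>2 \<le> (L2_norm \<Omega> (\<lambda>x. sqrt (m' x) *\<^sub>R grad_vec \<Omega> v' x))\<^sup>2"
    unfolding dissip unfolding L2_norm_power2 integral_mult_right_zero[symmetric]
  proof (rule integral_mono_AE[OF integrable_mult_right[OF gv'] intD])
    show "AE x in lebesgue_on \<Omega>. \<mu>min * (grad_vec \<Omega> v' x \<bullet> grad_vec \<Omega> v' x)
        \<le> (m' x *\<^sub>R grad_vec \<Omega> v' x) \<bullet> grad_vec \<Omega> v' x"
      using visc by eventually_elim (simp add: mult_right_mono)
  qed
  have intg: "integrable (lebesgue_on \<Omega>) (\<lambda>x. ?g x \<bullet> v' x)"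
    using reg v' by (simp add: regular_step_def testable_def)
  have gv: "integrable (lebesgue_on \<Omega>) (\<lambda>x. grad_vec \<Omega> v x \<bullet> grad_vec \<Omega> v x)"
    by (intro int H10_vec_in_L2 v)
  \<comment> \<open>The square of \<open>?b\<close> occurs once on the right of \<open>proj\<close>
    and twice on the left of the doubled momentum balance, which leaves it here with a minus
    sign.\<close>
  have "(LINT x|lebesgue_on \<Omega>. 2 * (?a x \<bullet> ?b x) - ?b x \<bullet> ?b x + 2 * \<tau> * (?g x \<bullet> v' x))
     \<le> (LINT x|lebesgue_on \<Omega>. (1 + \<kappa>) * (?a x \<bullet> ?a x + \<tau> * \<epsilon>v * \<mu>min * (grad_vec \<Omega> v x \<bullet> grad_vec \<Omega> v x)))"
  proof (rule integral_mono_AE)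
    show "AE x in lebesgue_on \<Omega>. 2 * (?a x \<bullet> ?b x) - ?b x \<bullet> ?b x + 2 * \<tau> * (?g x \<bullet> v' x)
       \<le> (1 + \<kappa>) * (?a x \<bullet> ?a x + \<tau> * \<epsilon>v * \<mu>min * (grad_vec \<Omega> v x \<bullet> grad_vec \<Omega> v x))"
      using visc pos
    proof eventually_elim
      case (elim x)
      \<comment> \<open>The coupling bound is split as \<open>k * z\<close> so that
        \<open>k\<^sup>2\<close> is \<kappa> and \<open>z\<^sup>2\<close> is the share of old
        dissipation available for it. The root of \<open>\<rho>low\<close> in the product comes from
        estimating \<open>v'\<close> by \<open>?b\<close>.\<close>
      define k where "k = L * sqrt (\<tau> / (\<epsilon>v * \<rho>low * \<mu>min))"
      define z where "z = sqrt (\<tau> * \<epsilon>v * \<mu>min) * norm (grad_vec \<Omega> v x)"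
      have k2: "k\<^sup>2 = \<kappa>" and z2: "z\<^sup>2 = \<tau> * \<epsilon>v * \<mu>min * (grad_vec \<Omega> v x \<bullet> grad_vec \<Omega> v x)"
        using low \<mu>min \<epsilon>v \<tau> by (auto simp: k_def z_def \<kappa> L_def power_mult_distrib power2_norm_eq_inner)
      have "sqrt (\<tau> / (\<epsilon>v * \<rho>low * \<mu>min)) * sqrt (\<tau> * \<epsilon>v * \<mu>min)
          = sqrt (\<tau>\<^sup>2 / \<rho>low)"
        using low \<mu>min \<epsilon>v \<tau> unfolding real_sqrt_mult[symmetric] by (simp add: power2_eq_square)
      also have "\<dots> = \<tau> / sqrt \<rho>low"
        using \<tau> by (simp add: real_sqrt_divide)
      finally have kz: "k * z = \<tau> * (norm (grad_vec \<Omega> v x) * L / sqrt \<rho>low)"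
        unfolding k_def z_def by (simp add: mult_ac)
      have L0: "0 \<le> L" using elim norm_ge_zero order_trans by blast
      have "?g x \<bullet> v' x \<le> norm (grad_vec \<Omega> v x) * norm (grad \<Omega> m' x) * norm (v' x)"
        by (rule inner_transpose_matrix_vector_le)
      also have "\<dots> \<le> norm (grad_vec \<Omega> v x) * L * (norm (?b x) / sqrt \<rho>low)"
      proof (intro mult_mono mult_nonneg_nonneg)
        have "norm (v' x) * sqrt \<rho>low \<le> norm (v' x) * sqrt (r' x)"
          using elim by (intro mult_left_mono) auto
        then show "norm (v' x) \<le> norm (?b x) / sqrt \<rho>low"
          using low elim by (simp add: le_divide_eq mult.commute)
      qed (use elim L0 in auto)
      finally have "\<tau> * (?g x \<bullet> v' x) \<le> \<tau> * (norm (grad_vec \<Omega> v x) * L * (norm (?b x) / sqrt \<rho>low))"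
        using \<tau> by (intro mult_left_mono) auto
      also have "\<dots> = (k * z) * norm (?b x)"
        unfolding kz by simp
      finally have "2 * (?a x \<bullet> ?b x) - ?b x \<bullet> ?b x + 2 * \<tau> * (?g x \<bullet> v' x)
        \<le> 2 * (?a x \<bullet> ?b x) - ?b x \<bullet> ?b x + 2 * (k * z) * norm (?b x)" by linarith
      also have "\<dots> \<le> (1 + k\<^sup>2) * (?a x \<bullet> ?a x + z\<^sup>2)" by (rule absorb_coupling)
      finally show ?case unfolding k2 z2 .
    qed
  qed (intro Bochner_Integration.integrable_add Bochner_Integration.integrable_diff integrable_mult_right int a b intg gv)+
  also have "\<dots> = (1 + \<kappa>) * ((L2_norm \<Omega> ?a)\<^sup>2 + \<tau> * \<epsilon>v * \<mu>min * (L2_norm \<Omega> (grad_vec \<Omega> v))\<^sup>2)"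
    unfolding L2_norm_power2
    by (subst Bochner_Integration.integral_add integral_mult_right_zero;
        (intro Bochner_Integration.integrable_add integrable_mult_right int a gv)?)+ (rule refl)
  also have "(LINT x|lebesgue_on \<Omega>. 2 * (?a x \<bullet> ?b x) - ?b x \<bullet> ?b x + 2 * \<tau> * (?g x \<bullet> v' x))
     = 2 * (LINT x|lebesgue_on \<Omega>. ?a x \<bullet> ?b x) - (L2_norm \<Omega> ?b)\<^sup>2 + 2 * \<tau> * (LINT x|lebesgue_on \<Omega>. ?g x \<bullet> v' x)"
    unfolding L2_norm_power2
    by (subst Bochner_Integration.integral_add Bochner_Integration.integral_diff integral_mult_right_zero;
        (intro Bochner_Integration.integrable_diff integrable_mult_right int a b intg)?)+ (rule refl)
  finally show "(L2_norm \<Omega> ?a')\<^sup>2 + \<tau>\<^sup>2 * (L2_norm \<Omega> ?P')\<^sup>2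
       + 2 * \<tau> * (L2_norm \<Omega> (\<lambda>x. sqrt (m' x) *\<^sub>R grad_vec \<Omega> v' x))\<^sup>2
     \<le> (1 + \<kappa>) * ((L2_norm \<Omega> ?a)\<^sup>2 + \<tau> * \<epsilon>v * \<mu>min * (L2_norm \<Omega> (grad_vec \<Omega> v))\<^sup>2)
       + \<tau>\<^sup>2 * (L2_norm \<Omega> ?P)\<^sup>2 + 2 * \<tau> * f' v'"
    using proj momentum_energy[OF low r r' \<tau> reg mom a P b]
    unfolding dissip L2_norm_power2[of \<Omega> ?b] by linarith
qed

section \<open>Summation over the time steps\<close>

text \<open>\<open>X\<close> is the energy entering a step and \<open>Y\<close> the possibly larger
  one leaving it. The induction runs on \<open>X\<close>, whose initial value is bounded by
  \<open>C\<close>; only the last step is left in terms of \<open>Y\<close>.\<close>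

lemma discrete_gronwall:
  fixes X Y D F :: "nat \<Rightarrow> real"
  assumes step: "\<And>n. n < N \<Longrightarrow> Y (Suc n) + D (Suc n) \<le> (1 + \<kappa>) * X n + F (Suc n)"
    and XY: "\<And>n. 0 < n \<Longrightarrow> n \<le> N \<Longrightarrow> X n \<le> Y n"
    and init: "X 0 \<le> C" and \<kappa>: "0 \<le> \<kappa>" and D: "\<And>n. 0 \<le> D n" and F: "\<And>n. 0 \<le> F n"
    and N: "0 < N"
  shows "Y N + (\<Sum>n=1..N. D n) \<le> (C + (\<Sum>n=1..N. F n)) * (1 + \<kappa>) ^ N"
proof -
  have next_bound: "Y (Suc n) + (\<Sum>k=1..Suc n. D k) \<le> (C + (\<Sum>k=1..Suc n. F k)) * (1 + \<kappa>) ^ Suc n"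
    if n: "n < N" and IH: "X n + (\<Sum>k=1..n. D k) \<le> (C + (\<Sum>k=1..n. F k)) * (1 + \<kappa>) ^ n" for n
  proof -
    have "Y (Suc n) + (\<Sum>k=1..Suc n. D k) \<le> (1 + \<kappa>) * X n + 1 * (\<Sum>k=1..n. D k) + F (Suc n) * 1"
      using step[OF n] by simp
    \<comment> \<open>Enlarging the accumulated dissipation and the new source by factors of at
      least 1 lets the whole accumulated quantity scale by \<open>1 + \<kappa>\<close>.\<close>
    also have "\<dots> \<le> (1 + \<kappa>) * X n + (1 + \<kappa>) * (\<Sum>k=1..n. D k) + F (Suc n) * (1 + \<kappa>) ^ Suc n"
      using \<kappa> D F by (intro add_mono mult_right_mono mult_left_mono one_le_power sum_nonneg order_refl) auto
    also have "\<dots> = (1 + \<kappa>) * (X n + (\<Sum>k=1..n. D k)) + F (Suc n) * (1 + \<kappa>) ^ Suc n"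
      by (simp only: distrib_left)
    also have "\<dots> \<le> (1 + \<kappa>) * ((C + (\<Sum>k=1..n. F k)) * (1 + \<kappa>) ^ n) + F (Suc n) * (1 + \<kappa>) ^ Suc n"
      using \<kappa> IH by (intro add_right_mono mult_left_mono) auto
    also have "\<dots> = (C + (\<Sum>k=1..Suc n. F k)) * (1 + \<kappa>) ^ Suc n"
      by (simp add: algebra_simps)
    finally show ?thesis .
  qed
  have "X n + (\<Sum>k=1..n. D k) \<le> (C + (\<Sum>k=1..n. F k)) * (1 + \<kappa>) ^ n" if "n \<le> N" for n
    using that
  proof (induction n)
    case 0
    then show ?case using init by simp
  next
    case (Suc n)
    then show ?case using next_bound[of n] XY[of "Suc n"] by simp
  qed
  then show ?thesis
    \<comment> \<open>The step from \<open>N - 1\<close> to \<open>N\<close> is taken once more,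
      without the final weakening of \<open>Y N\<close> to \<open>X N\<close>.\<close>
    using next_bound[of "N - 1"] N by simp
qed

text \<open>\<open>C\<close> is a function of \<tau> fixed before the final time, the discrete
  solution and both epsilons, so none of these can enter it. That it does not grow as \<tau>
  decreases is expressed by a nonnegative derivative.\<close>

theorem theorem4p4:
  fixes \<Omega> :: "(real^'d) set"
    and \<nu> :: "real^'d \<Rightarrow> real^'d"
    and \<rho>0 p0 :: "real^'d \<Rightarrow> real"
    and u0 :: "real^'d \<Rightarrow> real^'d"
    and \<mu> :: "(real^'d) \<times> real \<Rightarrow> real"
    and \<mu>min \<rho>min \<rho>max \<rho>low :: real
  assumes dim: "CARD('d) = 2 \<or> CARD('d) = 3"
    and domain: "domain_with_normal \<Omega> \<nu>"
    and mu_min: "0 < \<mu>min"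
    and rho_bounds: "0 < \<rho>min" "\<rho>min \<le> \<rho>max" "0 < \<rho>low" "\<rho>low \<le> \<rho>min"
    and rho0: "\<rho>0 \<in> borel_measurable (lebesgue_on \<Omega>)"
      "AE x in lebesgue_on \<Omega>. \<rho>min \<le> \<rho>0 x \<and> \<rho>0 x \<le> \<rho>max"
    and u0: "u0 \<in> H10_vec \<Omega>"
    and p0: "weakly_diff \<Omega> p0" "in_L2 \<Omega> (grad \<Omega> p0)"
  shows "\<exists>C :: real \<Rightarrow> real.
    (\<forall>\<tau>>0. 0 < C \<tau> \<and> (\<exists>D\<ge>0. (C has_real_derivative D) (at \<tau>))) \<and>
    (\<forall>(T::real) (N::nat) (\<tau>::real)
      (m :: nat \<Rightarrow> real^'d \<Rightarrow> real)
      (f :: nat \<Rightarrow> (real^'d \<Rightarrow> real^'d) \<Rightarrow> real)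
      (\<rho> :: nat \<Rightarrow> real^'d \<Rightarrow> real)
      (u :: nat \<Rightarrow> real^'d \<Rightarrow> real^'d)
      (p :: nat \<Rightarrow> real^'d \<Rightarrow> real)
      (uh :: nat \<Rightarrow> real^'d \<Rightarrow> real^'d)
      (\<epsilon>v::real) (\<epsilon>::real).
      T > 0 \<longrightarrow> N \<ge> 1 \<longrightarrow> \<tau> = T / real N \<longrightarrow>
      viscosity \<Omega> T \<mu>min \<mu> \<longrightarrow>
      (\<forall>n\<le>N. discrete_viscosity \<Omega> T \<mu>min \<mu> (m n)) \<longrightarrow>
      (\<forall>n\<le>N. f n \<in> Hm1_vec \<Omega>) \<longrightarrow>
      \<rho> 0 = \<rho>0 \<longrightarrow> u 0 = u0 \<longrightarrow> p 0 = p0 \<longrightarrow> uh 0 = u0 \<longrightarrow>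
      (\<forall>n\<le>N. AE x in lebesgue_on \<Omega>. \<rho>low \<le> \<rho> n x) \<longrightarrow>
      (\<forall>n<N. regular_step \<Omega> \<nu> (m (Suc n)) (\<rho> n) (\<rho> (Suc n)) (u n) (u (Suc n))
                (p n) (p (Suc n)) (uh n) (uh (Suc n))) \<longrightarrow>
      (\<forall>n<N. density_step \<Omega> \<tau> (\<rho> n) (\<rho> (Suc n)) (uh n)) \<longrightarrow>
      (\<forall>n<N. momentum_step \<Omega> \<tau> (m (Suc n)) (f (Suc n)) (\<rho> n) (\<rho> (Suc n))
                (u n) (u (Suc n)) (p n) (uh n)) \<longrightarrow>
      (\<forall>n<N. pressure_step \<Omega> \<nu> \<tau> (\<rho> n) (\<rho> (Suc n)) (u (Suc n)) (p n) (p (Suc n))) \<longrightarrow>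
      (\<forall>n<N. correction_step \<Omega> \<tau> (\<rho> n) (\<rho> (Suc n)) (u (Suc n)) (p n) (p (Suc n))
                (uh (Suc n))) \<longrightarrow>
      \<epsilon>v > 0 \<longrightarrow> \<epsilon> > 0 \<longrightarrow> \<epsilon>v + \<epsilon> \<le> 2 \<longrightarrow>
      (L2_norm \<Omega> (\<lambda>x. sqrt (\<rho> N x) *\<^sub>R uh N x))\<^sup>2
        + \<tau> * \<epsilon>v * (L2_norm \<Omega> (\<lambda>x. sqrt (m N x) *\<^sub>R grad_vec \<Omega> (u N) x))\<^sup>2
        + \<tau>\<^sup>2 * (L2_norm \<Omega> (\<lambda>x. (1 / sqrt (\<rho> N x)) *\<^sub>R grad \<Omega> (p N) x))\<^sup>2
        + (2 - \<epsilon> - \<epsilon>v) * \<tau> *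
            (\<Sum>n=1..N. (L2_norm \<Omega> (\<lambda>x. sqrt (m n x) *\<^sub>R grad_vec \<Omega> (u n) x))\<^sup>2)
      \<le> (C \<tau> + (\<Sum>n=1..N. \<tau> / (\<epsilon> * \<mu>min) * (Hm1_norm \<Omega> (f n))\<^sup>2))
          * exp (T * (Linf_norm (cylinder \<Omega> T) (space_grad \<Omega> T \<mu>))\<^sup>2 / (\<epsilon>v * \<rho>low * \<mu>min)))"
proof -
  define A0 where "A0 = (L2_norm \<Omega> (\<lambda>x. sqrt (\<rho>0 x) *\<^sub>R u0 x))\<^sup>2"
  define B0 where "B0 = (L2_norm \<Omega> (\<lambda>x. (1 / sqrt (\<rho>0 x)) *\<^sub>R grad \<Omega> p0 x))\<^sup>2"
  define G0 where "G0 = (L2_norm \<Omega> (grad_vec \<Omega> u0))\<^sup>2"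
  \<comment> \<open>The factor \<open>2\<close> bounds \<open>\<epsilon>v\<close>. Only \<open>\<mu>min\<close> and not \<open>m 0\<close> enters: the coupling term at the first step
    is absorbed by \<open>\<mu>min \<parallel>\<nabla>u\<^sub>0\<parallel>\<^sup>2\<close>.\<close>
  define C where "C \<tau> = 1 + A0 + \<tau>\<^sup>2 * B0 + 2 * \<mu>min * G0 * \<tau>" for \<tau>
  have nonneg: "0 \<le> A0" "0 \<le> B0" "0 \<le> G0"
    by (simp_all add: A0_def B0_def G0_def)
  have open\<Omega>: "open \<Omega>" using domain by (simp add: domain_with_normal_def)
  have \<rho>0low: "AE x in lebesgue_on \<Omega>. \<rho>low \<le> \<rho>0 x"
    using rho0(2) rho_bounds(4) by (auto elim!: eventually_mono)
  \<comment> \<open>At the initial level the bound \<open>\<rho>max\<close> controls the weight; at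
    later levels \<open>regular_step\<close> supplies this membership.\<close>
  have a0: "in_L2 \<Omega> (\<lambda>x. sqrt (\<rho>0 x) *\<^sub>R u0 x)"
  proof (rule in_L2_bounded_scaleR[OF H10_vec_in_L2(1)[OF u0]])
    show "(\<lambda>x. sqrt (\<rho>0 x)) \<in> borel_measurable (lebesgue_on \<Omega>)"
      using rho0(1) by measurable
    show "AE x in lebesgue_on \<Omega>. \<bar>sqrt (\<rho>0 x)\<bar> \<le> sqrt \<rho>max"
      using rho0(2) by eventually_elim (use rho_bounds in auto)
  qed
  have C: "0 < C \<tau> \<and> (\<exists>D\<ge>0. (C has_real_derivative D) (at \<tau>))" if "\<tau> > 0" for \<tau>
  proof (intro conjI exI)
    show "0 < C \<tau>"
      using that nonneg mu_min by (simp add: C_def add_pos_nonneg)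
    show "0 \<le> 2 * \<tau> * B0 + 2 * \<mu>min * G0"
      using that nonneg mu_min by simp
    show "(C has_real_derivative 2 * \<tau> * B0 + 2 * \<mu>min * G0) (at \<tau>)"
      unfolding C_def[abs_def] by (auto intro!: derivative_eq_intros)
  qed
  show ?thesis
  proof (intro exI[of _ C] conjI allI impI)
    show "0 < C \<tau>" if "\<tau> > 0" for \<tau> using C[OF that] ..
    show "\<exists>D\<ge>0. (C has_real_derivative D) (at \<tau>)" if "\<tau> > 0" for \<tau> using C[OF that] ..
  next
    fix T :: real and N :: nat and \<tau> :: real
      and m :: "nat \<Rightarrow> real^'d \<Rightarrow> real" and f :: "nat \<Rightarrow> (real^'d \<Rightarrow> real^'d) \<Rightarrow> real"
      and \<rho> :: "nat \<Rightarrow> real^'d \<Rightarrow> real" and u :: "nat \<Rightarrow> real^'d \<Rightarrow> real^'d"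
      and p :: "nat \<Rightarrow> real^'d \<Rightarrow> real" and uh :: "nat \<Rightarrow> real^'d \<Rightarrow> real^'d" and \<epsilon>v \<epsilon> :: real
    assume T: "T > 0" and N: "N \<ge> 1" and \<tau>T: "\<tau> = T / real N"
      and m: "\<forall>n\<le>N. discrete_viscosity \<Omega> T \<mu>min \<mu> (m n)"
      and f: "\<forall>n\<le>N. f n \<in> Hm1_vec \<Omega>"
      and init: "\<rho> 0 = \<rho>0" "u 0 = u0" "p 0 = p0" "uh 0 = u0"
      and \<rho>: "\<forall>n\<le>N. AE x in lebesgue_on \<Omega>. \<rho>low \<le> \<rho> n x"
      and reg: "\<forall>n<N. regular_step \<Omega> \<nu> (m (Suc n)) (\<rho> n) (\<rho> (Suc n)) (u n) (u (Suc n))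
                (p n) (p (Suc n)) (uh n) (uh (Suc n))"
      and mom: "\<forall>n<N. momentum_step \<Omega> \<tau> (m (Suc n)) (f (Suc n)) (\<rho> n) (\<rho> (Suc n))
                (u n) (u (Suc n)) (p n) (uh n)"
      and ps: "\<forall>n<N. pressure_step \<Omega> \<nu> \<tau> (\<rho> n) (\<rho> (Suc n)) (u (Suc n)) (p n) (p (Suc n))"
      and cs: "\<forall>n<N. correction_step \<Omega> \<tau> (\<rho> n) (\<rho> (Suc n)) (u (Suc n)) (p n) (p (Suc n)) (uh (Suc n))"
      and \<epsilon>v: "\<epsilon>v > 0" and \<epsilon>: "\<epsilon> > 0" and \<epsilon>2: "\<epsilon>v + \<epsilon> \<le> 2"
    define L where "L = Linf_norm (cylinder \<Omega> T) (space_grad \<Omega> T \<mu>)"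
    \<comment> \<open>This is the growth rate per step; since \<open>N * \<tau> = T\<close>,
      \<open>N\<close> of them add up to the exponent of the claim.\<close>
    define \<kappa> where "\<kappa> = \<tau> * L\<^sup>2 / (\<epsilon>v * \<rho>low * \<mu>min)"
    define A where "A n = (L2_norm \<Omega> (\<lambda>x. sqrt (\<rho> n x) *\<^sub>R uh n x))\<^sup>2" for n
    define B where "B n = (L2_norm \<Omega> (\<lambda>x. (1 / sqrt (\<rho> n x)) *\<^sub>R grad \<Omega> (p n) x))\<^sup>2" for n
    define G where "G n = (L2_norm \<Omega> (grad_vec \<Omega> (u n)))\<^sup>2" for n
    define D where "D n = (L2_norm \<Omega> (\<lambda>x. sqrt (m n x) *\<^sub>R grad_vec \<Omega> (u n) x))\<^sup>2" for n
    define F where "F n = \<tau> / (\<epsilon> * \<mu>min) * (Hm1_norm \<Omega> (f n))\<^sup>2" for n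
    have \<tau>: "\<tau> > 0" using T N \<tau>T by simp
    have \<kappa>0: "0 \<le> \<kappa>" using \<tau> \<epsilon>v mu_min rho_bounds(3) by (simp add: \<kappa>_def)
    have u: "u n \<in> H10_vec \<Omega>" if "n \<le> N" for n
      using that u0 init mom by (cases n) (auto simp: momentum_step_def Suc_le_eq)
    have a: "in_L2 \<Omega> (\<lambda>x. sqrt (\<rho> n x) *\<^sub>R uh n x)" if "n \<le> N" for n
      using that a0 init reg by (cases n) (auto simp: regular_step_def Suc_le_eq)
    have P: "in_L2 \<Omega> (\<lambda>x. (1 / sqrt (\<rho> n x)) *\<^sub>R grad \<Omega> (p n) x)" if n: "n \<le> N" for n
    proof (rule in_L2_inverse_sqrt_scaleR)
      show "in_L2 \<Omega> (grad \<Omega> (p n))"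
        using n p0 init reg by (cases n) (auto simp: regular_step_def H1_def Suc_le_eq)
      show "\<rho> n \<in> borel_measurable (lebesgue_on \<Omega>)"
        using n rho0 init reg by (cases n) (auto simp: regular_step_def Suc_le_eq intro: weakly_diff_measurable)
    qed (use \<rho> n rho_bounds in auto)
    have step: "A (Suc n) + \<tau>\<^sup>2 * B (Suc n) + 2 * \<tau> * D (Suc n)
         \<le> (1 + \<kappa>) * (A n + \<tau> * \<epsilon>v * \<mu>min * G n) + \<tau>\<^sup>2 * B n + 2 * \<tau> * f (Suc n) (u (Suc n))"
      and GD: "\<mu>min * G (Suc n) \<le> D (Suc n)" if n: "n < N" for n
    proof -
      have n': "n \<le> N" "Suc n \<le> N" using n by auto
      note * = step_energy[OF open\<Omega> rho_bounds(3) mu_min \<epsilon>v \<tau> \<rho>[rule_format, OF n'(1)] \<rho>[rule_format, OF n'(2)]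
          m[rule_format, OF n'(2)] u[OF n'(1)] a[OF n'(1)] P[OF n'(1)] reg[rule_format, OF n] mom[rule_format, OF n]
          ps[rule_format, OF n] cs[rule_format, OF n] \<kappa>_def[unfolded L_def]]
      show "A (Suc n) + \<tau>\<^sup>2 * B (Suc n) + 2 * \<tau> * D (Suc n)
         \<le> (1 + \<kappa>) * (A n + \<tau> * \<epsilon>v * \<mu>min * G n) + \<tau>\<^sup>2 * B n + 2 * \<tau> * f (Suc n) (u (Suc n))"
        unfolding A_def B_def D_def G_def by (rule *(1))
      show "\<mu>min * G (Suc n) \<le> D (Suc n)"
        unfolding D_def G_def by (rule *(2))
    qed
    have force: "2 * \<tau> * f (Suc n) (u (Suc n)) \<le> F (Suc n) + \<tau> * \<epsilon> * D (Suc n)" if n: "n < N" for n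
    proof -
      define h g where "h = Hm1_norm \<Omega> (f (Suc n))" and "g = L2_norm \<Omega> (grad_vec \<Omega> (u (Suc n)))"
      \<comment> \<open>Young's inequality with weight \<open>\<epsilon> * \<mu>min\<close>, which
        is the origin of the coefficient of the force in \<open>F\<close>.\<close>
      have "0 \<le> (h / (\<epsilon> * \<mu>min) - g)\<^sup>2 * (\<epsilon> * \<mu>min)"
        using \<epsilon> mu_min by simp
      also have "\<dots> = h\<^sup>2 / (\<epsilon> * \<mu>min) - 2 * (h * g) + \<epsilon> * (\<mu>min * g\<^sup>2)"
        using \<epsilon> mu_min by (simp add: power2_eq_square field_simps)
      finally have "2 * (h * g) \<le> h\<^sup>2 / (\<epsilon> * \<mu>min) + \<epsilon> * (\<mu>min * g\<^sup>2)" by simp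
      moreover have "f (Suc n) (u (Suc n)) \<le> h * g"
        using Hm1_norm_bound[of "f (Suc n)" \<Omega> "u (Suc n)"] f u n by (simp add: h_def g_def)
      moreover have "\<epsilon> * (\<mu>min * g\<^sup>2) \<le> \<epsilon> * D (Suc n)"
        using GD[OF n] \<epsilon> by (simp add: G_def g_def)
      ultimately have "2 * f (Suc n) (u (Suc n)) \<le> h\<^sup>2 / (\<epsilon> * \<mu>min) + \<epsilon> * D (Suc n)" by linarith
      then have "\<tau> * (2 * f (Suc n) (u (Suc n))) \<le> \<tau> * (h\<^sup>2 / (\<epsilon> * \<mu>min) + \<epsilon> * D (Suc n))"
        using \<tau> by (intro mult_left_mono) auto
      then show ?thesis by (simp add: F_def h_def algebra_simps)
    qed
    \<comment> \<open>The dissipation \<open>2 * \<tau> * D\<close> of a level is divided in three: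
      the share \<epsilon> pays for the force, the share \<open>\<epsilon>v\<close> stays in the
      energy to absorb the coupling of the next step, and the rest is summed.\<close>
    have "(A N + \<tau> * \<epsilon>v * D N + \<tau>\<^sup>2 * B N) + (\<Sum>n=1..N. (2 - \<epsilon> - \<epsilon>v) * \<tau> * D n)
        \<le> (C \<tau> + (\<Sum>n=1..N. F n)) * (1 + \<kappa>) ^ N"
    proof (rule discrete_gronwall[where X = "\<lambda>n. A n + \<tau> * \<epsilon>v * \<mu>min * G n + \<tau>\<^sup>2 * B n"
          and Y = "\<lambda>n. A n + \<tau> * \<epsilon>v * D n + \<tau>\<^sup>2 * B n"])
      fix n assume n: "n < N"
      \<comment> \<open>The pressure term would pass with factor 1; it is enlarged so that one
        factor multiplies the whole energy.\<close>
      have "\<tau>\<^sup>2 * B n \<le> (1 + \<kappa>) * (\<tau>\<^sup>2 * B n)"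
        using \<kappa>0 mult_right_mono[of 1 "1 + \<kappa>" "\<tau>\<^sup>2 * B n"] by (simp add: B_def)
      then have "A (Suc n) + \<tau>\<^sup>2 * B (Suc n) + 2 * \<tau> * D (Suc n)
          \<le> (1 + \<kappa>) * (A n + \<tau> * \<epsilon>v * \<mu>min * G n) + (1 + \<kappa>) * (\<tau>\<^sup>2 * B n) + F (Suc n) + \<tau> * \<epsilon> * D (Suc n)"
        using step[OF n] force[OF n] by linarith
      then show "A (Suc n) + \<tau> * \<epsilon>v * D (Suc n) + \<tau>\<^sup>2 * B (Suc n) + (2 - \<epsilon> - \<epsilon>v) * \<tau> * D (Suc n)
          \<le> (1 + \<kappa>) * (A n + \<tau> * \<epsilon>v * \<mu>min * G n + \<tau>\<^sup>2 * B n) + F (Suc n)"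
        by (simp add: algebra_simps)
    next
      fix n assume "0 < n" "n \<le> N"
      \<comment> \<open>The viscosity bound at level \<open>n\<close> is a by-product of the step
        that produced this level, hence the index \<open>n - 1\<close>.\<close>
      then have "\<mu>min * G n \<le> D n" using GD[of "n - 1"] by simp
      then have "(\<tau> * \<epsilon>v) * (\<mu>min * G n) \<le> (\<tau> * \<epsilon>v) * D n"
        using \<tau> \<epsilon>v by (intro mult_left_mono) auto
      then show "A n + \<tau> * \<epsilon>v * \<mu>min * G n + \<tau>\<^sup>2 * B n \<le> A n + \<tau> * \<epsilon>v * D n + \<tau>\<^sup>2 * B n"
        by (simp add: mult.assoc)
    next
      have "\<epsilon>v * (\<tau> * \<mu>min * G0) \<le> 2 * (\<tau> * \<mu>min * G0)"
        using \<tau> \<epsilon> \<epsilon>2 mu_min nonneg by (intro mult_right_mono) auto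
      then show "A 0 + \<tau> * \<epsilon>v * \<mu>min * G 0 + \<tau>\<^sup>2 * B 0 \<le> C \<tau>"
        by (simp add: A_def B_def G_def init C_def A0_def B0_def G0_def algebra_simps)
    next
      fix n
      show "0 \<le> (2 - \<epsilon> - \<epsilon>v) * \<tau> * D n" using \<tau> \<epsilon>2 by (simp add: D_def)
      show "0 \<le> F n" using \<tau> \<epsilon> mu_min by (simp add: F_def)
    qed (use \<kappa>0 N in auto)
    also have "\<dots> \<le> (C \<tau> + (\<Sum>n=1..N. F n)) * exp (T * L\<^sup>2 / (\<epsilon>v * \<rho>low * \<mu>min))"
    proof (rule mult_left_mono)
      have "(1 + \<kappa>) ^ N \<le> exp \<kappa> ^ N"
        using \<kappa>0 by (intro power_mono) (auto simp: exp_ge_add_one_self)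
      also have "\<dots> = exp (real N * \<kappa>)" by (simp add: exp_of_nat_mult)
      also have "real N * \<kappa> = T * L\<^sup>2 / (\<epsilon>v * \<rho>low * \<mu>min)"
        using N by (simp add: \<kappa>_def \<tau>T)
      finally show "(1 + \<kappa>) ^ N \<le> exp (T * L\<^sup>2 / (\<epsilon>v * \<rho>low * \<mu>min))" .
      show "0 \<le> C \<tau> + (\<Sum>n=1..N. F n)"
        using C[OF \<tau>] \<tau> \<epsilon> mu_min by (intro add_nonneg_nonneg sum_nonneg) (auto simp: F_def)
    qed
    finally show "(L2_norm \<Omega> (\<lambda>x. sqrt (\<rho> N x) *\<^sub>R uh N x))\<^sup>2
        + \<tau> * \<epsilon>v * (L2_norm \<Omega> (\<lambda>x. sqrt (m N x) *\<^sub>R grad_vec \<Omega> (u N) x))\<^sup>2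
        + \<tau>\<^sup>2 * (L2_norm \<Omega> (\<lambda>x. (1 / sqrt (\<rho> N x)) *\<^sub>R grad \<Omega> (p N) x))\<^sup>2
        + (2 - \<epsilon> - \<epsilon>v) * \<tau> *
            (\<Sum>n=1..N. (L2_norm \<Omega> (\<lambda>x. sqrt (m n x) *\<^sub>R grad_vec \<Omega> (u n) x))\<^sup>2)
      \<le> (C \<tau> + (\<Sum>n=1..N. \<tau> / (\<epsilon> * \<mu>min) * (Hm1_norm \<Omega> (f n))\<^sup>2))
          * exp (T * (Linf_norm (cylinder \<Omega> T) (space_grad \<Omega> T \<mu>))\<^sup>2 / (\<epsilon>v * \<rho>low * \<mu>min))"
      by (simp only: A_def B_def D_def F_def L_def sum_distrib_left)
  qed
qed

end
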